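(* Let $n\ge 1$, let $z_0,z_1,\dots,z_n$ be distinct complex numbers with $|z_k|>1$, and let $c_0,c_1,\dots,c_n$ be complex numbers with $\operatorname{Re} c_k>0$. Let $a(z)=z^n+a_1z^{n-1}+\dots+a_n$, $b(z)=z^n+b_1z^{n-1}+\dots+b_n$ and $\sigma(z)=z^n+\sigma_1z^{n-1}+\dots+\sigma_n$ be real Schur polynomials and $\rho>0$ a real number such that the rational function $f(z)=\frac12\frac{b(z)}{a(z)}$ is positive real and $w(z)=\rho\frac{\sigma(z)}{a(z)}$ satisfies $f(z)+f(z^{-1})=w(z)w(z^{-1})$. Suppose that $f$ satisfies the interpolation conditions $$f(z_k)=c_k,\qquad k=0,1,\dots,n.$$ Let $V$ be the $(n+1)\times(n+1)$ Vandermonde matrix whose row with index $k$ ($k=0,\dots,n$) is $(z_k^n,z_k^{n-1},\dots,z_k,1)$, let $C=\operatorname{diag}(c_0,c_1,\dots,c_n)$, and let $$T=\tfrac12\left[\tfrac12V^{-1}CV-I_{n+1}\right].$$ Assume that $I_{n+1}+T$ is nonsingular and define the $n$-vector $u$ and the $n\times n$ matrix $U$ by $$\begin{bmatrix}u&U\end{bmatrix}=\begin{bmatrix}0&I_n\end{bmatrix}(I_{n+1}+T)^{-1}T,$$ where $0$ denotes the zero $n$-vector. Let $P$ be the minimal symmetric solution of the algebraic Riccati equation $$P=FPF'+(g-FPh)(1-h'Ph)^{-1}(g-FPh)',$$ where $g$ is the $n$-vector such that $f(z)=\frac12+h'(zI-F)^{-1}g$. Then $$g=u+U\sigma+U\Gamma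 Ph,$$ $P$ satisfies the nonstandard Riccati equation (Covariance Extension Equation) $$P=\Gamma(P-Phh'P)\Gamma'+g(P)g(P)',\qquad g(P):=u+U\sigma+U\Gamma Ph,$$ and $a$ and $\rho$ are given by $$a=(I-U)(\Gamma Ph+\sigma)-u,\qquad \rho=\sqrt{1-h'Ph}.$$
   Context: A Schur polynomial is a polynomial all of whose roots lie in the open unit disc. A real rational function $f$ is positive real if it is analytic in the complement of the unit disc (including at infinity) and maps it to the right half-plane. A prime denotes transposition. The symbols $a=(a_1,\dots,a_n)'$ and $\sigma=(\sigma_1,\dots,\sigma_n)'$ also denote the $n$-vectors of coefficients of the polynomials $a(z)$ and $\sigma(z)$. Further, $h=(1,0,\dots,0)'\in\mathbb{R}^n$, $J$ is the $n\times n$ upward shift matrix (ones on the first superdiagonal, zeros elsewhere), $F=J-ah'$ and $\Gamma=J-\sigma h'$. "Minimal" refers to the Loewner (positive semidefinite) partial order on symmetric matrices, among the symmetric solutions $P$ (with $1-h'Ph\neq 0$, so that the equation makes sense).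
   Formalization: The formal theorem uses T = ½[2V⁻¹CV − I] instead of the printed T = ½[½V⁻¹CV − I]; with the printed constant the claim fails, e.g. n=1, z_0=2, z_1=3, c_k=1/2, a=b=σ=z+1/2, ρ=1, where g=0 but u+Uσ+UΓPh=−3/10. *)

theory Defs
  imports
    "HOL-Computational_Algebra.Polynomial"
    "HOL-Analysis.Complex_Analysis_Basics"
    "Jordan_Normal_Form.Gauss_Jordan_Elimination"
begin

unbundle no inner_syntax and no vec_syntax

abbreviation cpoly :: "real poly \<Rightarrow> complex poly" where
  "cpoly \<equiv> map_poly complex_of_real"

abbreviation cvec :: "real vec \<Rightarrow> complex vec" where
  "cvec \<equiv> map_vec complex_of_real"

abbreviation cmat :: "real mat \<Rightarrow> complex mat" where
  "cmat \<equiv> map_mat complex_of_real"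

(* The vector (v_1,...,v_n), stored with indices 0,...,n-1, encodes z^n + v_1 z^(n-1) + ... + v_n. *)
definition monic_poly :: "real vec \<Rightarrow> real poly" where
  "monic_poly v =
     monom 1 (dim_vec v) + (\<Sum>i<dim_vec v. monom (v $ i) (dim_vec v - Suc i))"

definition schur_poly :: "real poly \<Rightarrow> bool" where
  "schur_poly p \<longleftrightarrow> (\<forall>z. poly (cpoly p) z = 0 \<longrightarrow> cmod z < 1)"

definition real_rational :: "(complex \<Rightarrow> complex) \<Rightarrow> bool" where
  "real_rational f \<longleftrightarrow>
     (\<exists>p q. q \<noteq> 0 \<and> (\<forall>z. f z = poly (cpoly p) z / poly (cpoly q) z))"

(* Analyticity on {z. |z| > 1} together with the point at infinity is analyticity of z |-> f (1/z)
   on the open unit disc, after filling in the value at 0. *)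
definition positive_real :: "(complex \<Rightarrow> complex) \<Rightarrow> bool" where
  "positive_real f \<longleftrightarrow> real_rational f \<and>
     (\<exists>G. G holomorphic_on ball 0 1 \<and>
          (\<forall>\<zeta>\<in>ball 0 1 - {0}. G \<zeta> = f (inverse \<zeta>)) \<and>
          (\<forall>\<zeta>\<in>ball 0 1. Re (G \<zeta>) > 0))"

(* Only meaningful for nonsingular A. *)
definition mat_inv :: "'a :: field mat \<Rightarrow> 'a mat" where
  "mat_inv A = the (mat_inverse A)"

(* v w' *)
definition outer_prod :: "'a :: times vec \<Rightarrow> 'a vec \<Rightarrow> 'a mat" where
  "outer_prod v w = mat (dim_vec v) (dim_vec w) (\<lambda>(i, j). v $ i * w $ j)"

(* [v A] *)
definition augment :: "'a vec \<Rightarrow> 'a mat \<Rightarrow> 'a mat" where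
  "augment v A = mat_of_cols (dim_vec v) (v # cols A)"

abbreviation h_vec :: "nat \<Rightarrow> 'a :: zero_neq_one vec" where
  "h_vec n \<equiv> unit_vec n 0"

definition shift_mat :: "nat \<Rightarrow> 'a :: zero_neq_one mat" where
  "shift_mat n = mat n n (\<lambda>(i, j). if j = Suc i then 1 else 0)"

(* J - v h': this is F for v = a and Gamma for v = sigma. *)
definition companion :: "real vec \<Rightarrow> real mat" where
  "companion v = shift_mat (dim_vec v) - outer_prod v (h_vec (dim_vec v))"

definition vandermonde :: "nat \<Rightarrow> (nat \<Rightarrow> complex) \<Rightarrow> complex mat" where
  "vandermonde n z = mat (n + 1) (n + 1) (\<lambda>(k, j). z k ^ (n - j))"

definition loewner_le :: "nat \<Rightarrow> real mat \<Rightarrow> real mat \<Rightarrow> bool" where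
  "loewner_le n A B \<longleftrightarrow> (\<forall>x\<in>carrier_vec n. x \<bullet> ((B - A) *\<^sub>v x) \<ge> 0)"

definition riccati_solution :: "nat \<Rightarrow> real mat \<Rightarrow> real vec \<Rightarrow> real mat \<Rightarrow> bool" where
  "riccati_solution n F g P \<longleftrightarrow>
     P \<in> carrier_mat n n \<and> P\<^sup>T = P \<and> 1 - h_vec n \<bullet> (P *\<^sub>v h_vec n) \<noteq> 0 \<and>
     P = F * P * F\<^sup>T +
         inverse (1 - h_vec n \<bullet> (P *\<^sub>v h_vec n)) \<cdot>\<^sub>m
           outer_prod (g - F *\<^sub>v (P *\<^sub>v h_vec n)) (g - F *\<^sub>v (P *\<^sub>v h_vec n))"

definition minimal_riccati_solution ::
  "nat \<Rightarrow> real mat \<Rightarrow> real vec \<Rightarrow> real mat \<Rightarrow> bool" where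
  "minimal_riccati_solution n F g P \<longleftrightarrow>
     riccati_solution n F g P \<and>
     (\<forall>Q. riccati_solution n F g Q \<and> loewner_le n Q P \<longrightarrow> Q = P)"

(* Since f = (1/2) b/a, the conditions f(z_k) = c_k read V(1,b)' = 2CV(1,a)'; as g = (b - a)/2,
   T is the matrix with (0,g)' = T(1,a)'. This fixes the factor 2 in front of V^(-1)CV: with the
   factor 1/2 that relation, and with it g = u + U sigma + U Gamma P h, fails
   (n = 1, z_0 = 2, z_1 = 3, c_k = 1/2, a = b = sigma = z + 1/2, rho = 1, P = 0). *)
definition interp_mat :: "nat \<Rightarrow> (nat \<Rightarrow> complex) \<Rightarrow> (nat \<Rightarrow> complex) \<Rightarrow> complex mat" where
  "interp_mat n z c =
     (1/2) \<cdot>\<^sub>m (2 \<cdot>\<^sub>m (mat_inv (vandermonde n z) * mat_diag (n + 1) c * vandermonde n z)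
             - 1\<^sub>m (n + 1))"

(* g(P) = u + U sigma + U Gamma P h. The nodes need not be closed under conjugation, so u and U
   may be complex. *)
definition g_fun :: "complex vec \<Rightarrow> complex mat \<Rightarrow> real vec \<Rightarrow> real mat \<Rightarrow> complex vec" where
  "g_fun u U \<sigma> P =
     u + U *\<^sub>v cvec \<sigma> + U *\<^sub>v cvec (companion \<sigma> *\<^sub>v (P *\<^sub>v h_vec (dim_vec \<sigma>)))"

end

theory Submission
  imports Defs "Jordan_Normal_Form.Spectral_Radius"
begin

text \<open>
  The idea is to write down one solution of the Riccati equation explicitly and to show that it is
  the smallest one. The condition \<open>f(x) + f(1/x) = w(x) w(1/x)\<close> says that the polynomial
  \<open>r(x, y) = \<rho>\<^sup>2 \<sigma>(x) \<sigma>(y) - (a(x) b(y) + b(x) a(y)) / 2\<close> vanishes whenever \<open>x y = 1\<close>, so it is divisible by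
  \<open>1 - x y\<close> and the quotient defines a symmetric matrix \<open>M\<close>. With the gain \<open>k = \<sigma> - a\<close>, comparison of
  coefficients gives directly
  \<open>F M F' = M - \<rho>\<^sup>2 k k'\<close>, \<open>F M h = g - \<rho>\<^sup>2 k\<close> and \<open>h' M h = 1 - \<rho>\<^sup>2\<close>
  (lemmas \<open>F_congruence_M\<close>, \<open>F_M_h\<close>, \<open>M00\<close>), whence \<open>M\<close> solves the Riccati equation. No Lyapunov equation
  for \<open>F\<close> has to be solved.

  If \<open>P\<close> is another solution, completing the square with the gain of \<open>M\<close> shows that \<open>P - M\<close> equals
  \<open>\<Gamma> (P - M) \<Gamma>'\<close> plus a rank-one term with the sign of \<open>1 - h'Ph\<close> (\<open>riccati_difference\<close>). The matrix \<open>\<Gamma>\<close>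
  is stable because \<open>\<sigma>\<close> is a Schur polynomial, so \<open>P - M\<close> is semidefinite with this sign. A negative
  sign would give \<open>h'Ph \<le> h'Mh < 1\<close>, a contradiction; thus \<open>M \<le> P\<close> (\<open>M_minimum\<close>), and the minimal
  solution is \<open>M\<close>. The formula for \<open>\<rho>\<close> is then \<open>h'Mh = 1 - \<rho>\<^sup>2\<close>, and since \<open>\<Gamma> = F - k h'\<close>, one gets
  \<open>\<Gamma> M h = g - k\<close>, that is \<open>\<Gamma> M h + \<sigma> = a + g\<close>, and the Covariance Extension Equation.

  The interpolation conditions enter only through \<open>g\<close>. They mean \<open>T (1, a)' = (0, g)'\<close>
  (\<open>interp_mat_mult\<close>), which after the transformation by \<open>I + T\<close> reads \<open>g = u + U (a + g)\<close>
  (\<open>interpolation_gain\<close>). Substituting \<open>a + g = \<Gamma> P h + \<sigma>\<close> gives the formulas for \<open>g\<close> and for \<open>a\<close>.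
\<close>

section \<open>Companion matrices\<close>

lemma mult_h_vec:
  fixes A :: "'a :: comm_semiring_1 mat"
  assumes "A \<in> carrier_mat m n" "0 < n"
  shows "A *\<^sub>v h_vec n = col A 0"
  using assms by (intro eq_vecI) (auto simp: scalar_prod_right_unit)

lemma mult_mat_vec_in_carrier: "A \<in> carrier_mat m n \<Longrightarrow> A *\<^sub>v v \<in> carrier_vec m"
  by (rule carrier_vecI) simp

text \<open>Multiplication by the shift moves every index up by one and drops what leaves the matrix.
  Extending the entries by zero makes the resulting formulas free of case distinctions.\<close>

definition padded :: "nat \<Rightarrow> 'a :: zero mat \<Rightarrow> nat \<Rightarrow> nat \<Rightarrow> 'a" where
  "padded n X i j = (if i < n \<and> j < n then X $$ (i, j) else 0)"

lemma outer_prod_carrier [simp]: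
  "v \<in> carrier_vec m \<Longrightarrow> w \<in> carrier_vec n \<Longrightarrow> outer_prod v w \<in> carrier_mat m n"
  by (simp add: outer_prod_def)

lemma outer_prod_index [simp]:
  "i < dim_vec v \<Longrightarrow> j < dim_vec w \<Longrightarrow> outer_prod v w $$ (i, j) = v $ i * w $ j"
  "dim_row (outer_prod v w) = dim_vec v" "dim_col (outer_prod v w) = dim_vec w"
  by (simp_all add: outer_prod_def)

lemma companion_carrier [simp]: "v \<in> carrier_vec n \<Longrightarrow> companion v \<in> carrier_mat n n"
  by (auto simp: companion_def shift_mat_def outer_prod_def)

lemma companion_dim [simp]:
  "dim_row (companion v) = dim_vec v" "dim_col (companion v) = dim_vec v"
  by (simp_all add: companion_def)

lemma companion_index:
  assumes "i < dim_vec v" "j < dim_vec v"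
  shows "companion v $$ (i, j) = (if j = Suc i then 1 else 0) - (if j = 0 then v $ i else 0)"
  using assms by (auto simp: companion_def shift_mat_def outer_prod_def)

lemma companion_sum:
  fixes y :: "nat \<Rightarrow> 'a :: real_algebra_1"
  assumes "i < dim_vec v"
  shows "(\<Sum>j<dim_vec v. of_real (companion v $$ (i, j)) * y j)
         = (if Suc i < dim_vec v then y (Suc i) else 0) - of_real (v $ i) * y 0"
proof -
  have "(\<Sum>j<dim_vec v. of_real (companion v $$ (i, j)) * y j)
      = (\<Sum>j<dim_vec v. (if j = Suc i then y j else 0) - (if j = 0 then of_real (v $ i) * y j else 0))"
    using assms by (intro sum.cong) (auto simp: companion_index)
  also have "\<dots> = (if Suc i < dim_vec v then y (Suc i) else 0) - of_real (v $ i) * y 0"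
    using assms by (auto simp: sum_subtractf)
  finally show ?thesis .
qed

lemma companion_mult_vec:
  assumes "x \<in> carrier_vec n" "v \<in> carrier_vec n" "i < n"
  shows "(companion v *\<^sub>v x) $ i = (if Suc i < n then x $ Suc i else 0) - v $ i * x $ 0"
  using assms companion_sum[of i v "\<lambda>j. x $ j"]
  by (auto simp: scalar_prod_def atLeast0LessThan)

lemma cmat_companion_mult_vec:
  assumes "x \<in> carrier_vec n" "v \<in> carrier_vec n" "i < n"
  shows "(cmat (companion v) *\<^sub>v x) $ i
         = (if Suc i < n then x $ Suc i else 0) - complex_of_real (v $ i) * x $ 0"
  using assms companion_sum[of i v "\<lambda>j. x $ j"]
  by (auto simp: scalar_prod_def atLeast0LessThan)

lemma companion_congruence:
  assumes "v \<in> carrier_vec n" "X \<in> carrier_mat n n" "i < n" "j < n"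
  shows "(companion v * X * (companion v)\<^sup>T) $$ (i, j)
         = padded n X (Suc i) (Suc j) - v $ i * padded n X 0 (Suc j) - v $ j * padded n X (Suc i) 0
           + v $ i * v $ j * X $$ (0, 0)"
proof -
  have left: "(companion v * X) $$ (i, k) = padded n X (Suc i) k - v $ i * X $$ (0, k)"
    if "k < n" for k
    using assms that companion_sum[of i v "\<lambda>l. X $$ (l, k)"]
    by (auto simp: scalar_prod_def atLeast0LessThan padded_def)
  have "(companion v * X * (companion v)\<^sup>T) $$ (i, j)
      = (\<Sum>k<n. companion v $$ (j, k) * (companion v * X) $$ (i, k))"
  proof -
    have "(companion v * X * (companion v)\<^sup>T) $$ (i, j)
        = row (companion v * X) i \<bullet> row (companion v) j"
      using assms by (subst index_mult_mat(1)) auto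
    also have "\<dots> = (\<Sum>k<n. (companion v * X) $$ (i, k) * companion v $$ (j, k))"
      unfolding scalar_prod_def atLeast0LessThan using assms
      by (intro sum.cong) (auto simp del: index_mult_mat(1))
    finally show ?thesis by (simp add: mult.commute)
  qed
  also have "\<dots> = (if Suc j < n then (companion v * X) $$ (i, Suc j) else 0)
                  - v $ j * (companion v * X) $$ (i, 0)"
    using assms companion_sum[of j v "\<lambda>k. (companion v * X) $$ (i, k)"] by simp
  also have "\<dots> = padded n X (Suc i) (Suc j) - v $ i * padded n X 0 (Suc j) - v $ j * padded n X (Suc i) 0
           + v $ i * v $ j * X $$ (0, 0)"
    using assms(3,4) by (auto simp: left padded_def algebra_simps simp del: index_mult_mat(1))
  finally show ?thesis .
qed

lemma poly_cpoly_monic_poly: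
  assumes "v \<in> carrier_vec n"
  shows "poly (cpoly (monic_poly v)) x
         = (\<Sum>i\<le>n. complex_of_real (vCons 1 v $ i) * x ^ (n - i))"
proof -
  have hom: "cpoly (\<Sum>i\<in>A. p i) = (\<Sum>i\<in>A. cpoly (p i))" for A and p :: "nat \<Rightarrow> real poly"
    by (rule poly_eqI) (simp add: coeff_map_poly coeff_sum)
  have add: "cpoly (p + q) = cpoly p + cpoly q" for p q
    by (rule poly_eqI) (simp add: coeff_map_poly)
  have "poly (cpoly (monic_poly v)) x
      = x ^ n + (\<Sum>i<n. complex_of_real (v $ i) * x ^ (n - Suc i))"
    using assms by (simp add: monic_poly_def add hom map_poly_monom poly_monom poly_sum)
  also have "\<dots> = (\<Sum>i<Suc n. complex_of_real (vCons 1 v $ i) * x ^ (n - i))"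
    by (subst sum.lessThan_Suc_shift) simp
  finally show ?thesis by (simp add: lessThan_Suc_atMost)
qed

text \<open>The row \<open>(x^(n-1), ..., x, 1)\<close> is, up to the factor \<open>v(x)\<close>, the first row of the resolvent:
  \<open>(x^(n-1), ..., x, 1) (x I - (J - v h')) = v(x) h'\<close>, because the shift turns every power of \<open>x\<close>
  into the next one and only the first column contains the coefficients \<open>v\<close>. This replaces the
  computation of the characteristic polynomial and of the inverse.\<close>

lemma companion_left_power_row:
  assumes "v \<in> carrier_vec n" "y \<in> carrier_vec n" "0 < n"
  shows "(\<Sum>i<n. x ^ (n - Suc i) * (x * y $ i - (cmat (companion v) *\<^sub>v y) $ i))
         = poly (cpoly (monic_poly v)) x * y $ 0"
proof -
  obtain m where n: "n = Suc m" using assms(3) by (cases n) auto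
  have "(\<Sum>i<n. x ^ (n - Suc i) * (x * y $ i - (cmat (companion v) *\<^sub>v y) $ i))
     = (\<Sum>i<n. x ^ (n - i) * y $ i - (if Suc i < n then x ^ (n - Suc i) * y $ Suc i else 0)
              + complex_of_real (v $ i) * x ^ (n - Suc i) * y $ 0)"
  proof (intro sum.cong refl)
    fix i assume "i \<in> {..<n}"
    hence i: "i < n" by simp
    hence "x ^ (n - i) = x ^ (n - Suc i) * x" by (metis Suc_diff_Suc power_Suc2)
    thus "x ^ (n - Suc i) * (x * y $ i - (cmat (companion v) *\<^sub>v y) $ i) =
      x ^ (n - i) * y $ i - (if Suc i < n then x ^ (n - Suc i) * y $ Suc i else 0)
              + complex_of_real (v $ i) * x ^ (n - Suc i) * y $ 0"
      unfolding cmat_companion_mult_vec[OF assms(2,1) i] by (simp add: algebra_simps)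
  qed
  also have "\<dots> = (\<Sum>i<n. x ^ (n - i) * y $ i)
      - (\<Sum>i<n. if Suc i < n then x ^ (n - Suc i) * y $ Suc i else 0)
      + (\<Sum>i<n. complex_of_real (v $ i) * x ^ (n - Suc i)) * y $ 0"
    by (simp add: sum.distrib sum_subtractf sum_distrib_right)
  also have "(\<Sum>i<n. if Suc i < n then x ^ (n - Suc i) * y $ Suc i else 0)
      = (\<Sum>i<m. x ^ (n - Suc i) * y $ Suc i)"
    unfolding n by simp
  also have "(\<Sum>i<n. x ^ (n - i) * y $ i) = x ^ n * y $ 0 + (\<Sum>i<m. x ^ (n - Suc i) * y $ Suc i)"
    unfolding n by (subst sum.lessThan_Suc_shift) simp
  also have "poly (cpoly (monic_poly v)) x = x ^ n + (\<Sum>i<n. complex_of_real (v $ i) * x ^ (n - Suc i))"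
    unfolding poly_cpoly_monic_poly[OF assms(1)] lessThan_Suc_atMost[symmetric]
    by (subst sum.lessThan_Suc_shift) simp
  ultimately show ?thesis by (simp add: algebra_simps)
qed

text \<open>If \<open>v(x)\<close> is nonzero, the row identity above forces the first component of a vector in the
  kernel of \<open>x I - (J - v h')\<close> to vanish, and the shift then propagates this to all others.\<close>

lemma companion_kernel:
  assumes "v \<in> carrier_vec n" "y \<in> carrier_vec n"
    and "poly (cpoly (monic_poly v)) x \<noteq> 0"
    and eig: "cmat (companion v) *\<^sub>v y = x \<cdot>\<^sub>v y"
  shows "y = 0\<^sub>v n"
proof (cases "n = 0")
  case True
  thus ?thesis using assms by (intro eq_vecI) auto
next
  case False
  have "(\<Sum>i<n. x ^ (n - Suc i) * (x * y $ i - (cmat (companion v) *\<^sub>v y) $ i)) = 0"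
    using assms(2) eig by (intro sum.neutral) auto
  hence y0: "y $ 0 = 0"
    using companion_left_power_row[OF assms(1,2), of x] assms(3) False by simp
  have "y $ i = 0" if "i < n" for i
    using that
  proof (induction i)
    case (Suc i)
    have "(x \<cdot>\<^sub>v y) $ i = y $ Suc i"
      using cmat_companion_mult_vec[OF assms(2,1), of i] Suc.prems y0 by (simp add: eig)
    thus ?case using Suc assms(2) by simp
  qed (use y0 in simp)
  thus ?thesis using assms(2) by (intro eq_vecI) auto
qed

section \<open>Inverses and the vanishing of polynomial coefficients\<close>

lemma mat_inv_of_det:
  fixes A :: "'a :: field mat"
  assumes A: "A \<in> carrier_mat n n" and "det A \<noteq> 0"
  shows "mat_inv A \<in> carrier_mat n n" "A * mat_inv A = 1\<^sub>m n" "mat_inv A * A = 1\<^sub>m n"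
proof -
  have "A \<in> Units (ring_mat TYPE('a) n ())"
    using assms by (rule det_non_zero_imp_unit)
  then obtain B where "mat_inverse A = Some B"
    using mat_inverse(1)[OF A, of "()"] by (cases "mat_inverse A") auto
  thus "mat_inv A \<in> carrier_mat n n" "A * mat_inv A = 1\<^sub>m n" "mat_inv A * A = 1\<^sub>m n"
    using mat_inverse(2)[OF A] by (simp_all add: mat_inv_def)
qed

lemma mat_inv_of_trivial_kernel:
  fixes A :: "'a :: field mat"
  assumes A: "A \<in> carrier_mat n n"
    and ker: "\<And>v. v \<in> carrier_vec n \<Longrightarrow> A *\<^sub>v v = 0\<^sub>v n \<Longrightarrow> v = 0\<^sub>v n"
  shows "mat_inv A \<in> carrier_mat n n" "A * mat_inv A = 1\<^sub>m n" "mat_inv A * A = 1\<^sub>m n"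
proof -
  have "det A \<noteq> 0" using ker by (auto simp: det_0_iff_vec_prod_zero[OF A])
  from mat_inv_of_det[OF A this]
  show "mat_inv A \<in> carrier_mat n n" "A * mat_inv A = 1\<^sub>m n" "mat_inv A * A = 1\<^sub>m n" .
qed

lemma mat_inv_of_invertible:
  fixes A :: "'a :: field mat"
  assumes A: "A \<in> carrier_mat n n" and "invertible_mat A"
  shows "mat_inv A \<in> carrier_mat n n" "A * mat_inv A = 1\<^sub>m n" "mat_inv A * A = 1\<^sub>m n"
proof -
  obtain B where B: "A * B = 1\<^sub>m n" "B * A = 1\<^sub>m (dim_row B)"
    using assms by (auto simp: invertible_mat_def inverts_mat_def)
  have "B \<in> carrier_mat n n"
    using arg_cong[OF B(1), of dim_col] arg_cong[OF B(2), of dim_col] A by (intro carrier_matI) auto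
  hence "det A * det B = 1" using det_mult[OF A] B(1) by (metis det_one)
  hence "det A \<noteq> 0" by auto
  from mat_inv_of_det[OF A this]
  show "mat_inv A \<in> carrier_mat n n" "A * mat_inv A = 1\<^sub>m n" "mat_inv A * A = 1\<^sub>m n" .
qed

text \<open>Serves twice: with the nodes as zeros it shows that a Vandermonde matrix has trivial kernel, and
  with enough arbitrary points it turns an identity of rational functions into one of coefficients.\<close>

lemma power_sum_coeffs_zero:
  fixes y :: "nat \<Rightarrow> complex"
  assumes zeros: "card Z > n" and finz: "finite Z"
    and vanish: "\<And>x. x \<in> Z \<Longrightarrow> (\<Sum>j\<le>n. x ^ (n - j) * y j) = 0"
    and "j \<le> n"
  shows "y j = 0"
proof -
  define p where "p = (\<Sum>i\<le>n. monom (y (n - i)) i)"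
  have pe: "poly p x = (\<Sum>j\<le>n. x ^ (n - j) * y j)" for x
  proof -
    have "poly p x = (\<Sum>i\<le>n. y (n - i) * x ^ i)" by (simp add: p_def poly_sum poly_monom)
    also have "\<dots> = (\<Sum>j\<le>n. x ^ (n - j) * y j)"
      by (rule sum.reindex_bij_witness[of _ "\<lambda>j. n - j" "\<lambda>j. n - j"]) auto
    finally show ?thesis .
  qed
  have cf: "coeff p k = (if k \<le> n then y (n - k) else 0)" for k
    by (auto simp: p_def coeff_sum)
  have "degree p \<le> n" by (rule degree_le) (simp add: cf)
  have "p = 0"
  proof (rule ccontr)
    assume "p \<noteq> 0"
    have "card Z \<le> card {x. poly p x = 0}"
      by (rule card_mono[OF poly_roots_finite]) (auto simp: \<open>p \<noteq> 0\<close> pe vanish)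
    also have "\<dots> \<le> degree p" using \<open>p \<noteq> 0\<close> by (rule card_poly_roots_bound)
    finally show False using zeros \<open>degree p \<le> n\<close> by simp
  qed
  thus ?thesis using cf[of "n - j"] \<open>j \<le> n\<close> by simp
qed

section \<open>Stable matrices and Lyapunov equations\<close>

lemma eigenvalue_companion:
  assumes "v \<in> carrier_vec n" "eigenvalue (cmat (companion v)) x"
  shows "poly (cpoly (monic_poly v)) x = 0"
proof -
  obtain y where y: "y \<in> carrier_vec n" "y \<noteq> 0\<^sub>v n" "cmat (companion v) *\<^sub>v y = x \<cdot>\<^sub>v y"
    using assms by (auto simp: eigenvalue_def eigenvector_def)
  show ?thesis
    using companion_kernel[OF assms(1) y(1) _ y(3)] y(2) by auto
qed

lemma spectral_radius_companion_less_1: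
  assumes "v \<in> carrier_vec n" "0 < n" "schur_poly (monic_poly v)"
  shows "spectral_radius (cmat (companion v)) < 1"
proof -
  have "cmat (companion v) \<in> carrier_mat n n" using assms(1) by simp
  from spectral_radius_mem_max(1)[OF this assms(2)]
  obtain x where "eigenvalue (cmat (companion v)) x" "spectral_radius (cmat (companion v)) = cmod x"
    by (auto simp: spectrum_def)
  thus ?thesis using eigenvalue_companion[OF assms(1)] assms(3) by (auto simp: schur_poly_def)
qed

lemma smult_mat_mult_vec:
  fixes A :: "'a :: comm_semiring_1 mat"
  assumes "A \<in> carrier_mat m n" "x \<in> carrier_vec n"
  shows "(c \<cdot>\<^sub>m A) *\<^sub>v x = c \<cdot>\<^sub>v (A *\<^sub>v x)"
  using assms by (intro eq_vecI) (auto simp: scalar_prod_def sum_distrib_left mult_ac)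

lemma smult_pow_mat:
  fixes A :: "'a :: comm_semiring_1 mat"
  assumes "A \<in> carrier_mat n n"
  shows "(c \<cdot>\<^sub>m A) ^\<^sub>m k = c ^ k \<cdot>\<^sub>m (A ^\<^sub>m k)"
proof (induction k)
  case (Suc k)
  have "(c \<cdot>\<^sub>m A) ^\<^sub>m Suc k = (c ^ k \<cdot>\<^sub>m (A ^\<^sub>m k)) * (c \<cdot>\<^sub>m A)" using Suc by simp
  also have "\<dots> = c ^ Suc k \<cdot>\<^sub>m (A ^\<^sub>m k * A)"
    using assms pow_carrier_mat[OF assms, of k]
    by (intro eq_matI) (auto simp: mult_ac)
  finally show ?case by simp
qed (use assms in \<open>auto intro!: eq_matI\<close>)

text \<open>A spectral radius below 1 is known to bound the powers; decay is obtained by applying this to the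
  matrix divided by some \<open>s\<close> strictly between the spectral radius and 1.\<close>

lemma pow_mat_tendsto_0:
  assumes A: "A \<in> carrier_mat n n" and n: "0 < n" and rad: "spectral_radius A < 1"
    and ij: "i < n" "j < n"
  shows "(\<lambda>k. (A ^\<^sub>m k) $$ (i, j)) \<longlonglongrightarrow> 0"
proof -
  obtain s where s: "max 0 (spectral_radius A) < s" "s < 1"
    using dense[of "max 0 (spectral_radius A)" 1] rad by auto
  define B where "B = complex_of_real (inverse s) \<cdot>\<^sub>m A"
  have B: "B \<in> carrier_mat n n" using A by (simp add: B_def)
  have AB: "A = complex_of_real s \<cdot>\<^sub>m B"
    using s A by (intro eq_matI) (auto simp: B_def)
  obtain x where x: "eigenvalue B x" "spectral_radius B = cmod x"
    using spectral_radius_mem_max(1)[OF B n] by (auto simp: spectrum_def)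
  obtain y where y: "y \<in> carrier_vec n" "y \<noteq> 0\<^sub>v n" "B *\<^sub>v y = x \<cdot>\<^sub>v y"
    using x(1) B by (auto simp: eigenvalue_def eigenvector_def)
  have "A *\<^sub>v y = complex_of_real s \<cdot>\<^sub>v (B *\<^sub>v y)"
    unfolding AB using B y(1) by (rule smult_mat_mult_vec)
  hence "A *\<^sub>v y = (complex_of_real s * x) \<cdot>\<^sub>v y" using y(3) by (simp add: smult_smult_assoc)
  hence "eigenvalue A (complex_of_real s * x)"
    using y A by (auto simp: eigenvalue_def eigenvector_def)
  hence "cmod (complex_of_real s * x) \<le> spectral_radius A"
    by (intro spectral_radius_mem_max(2)[OF A n]) (simp add: spectrum_def)
  hence "s * cmod x \<le> spectral_radius A" using s by (simp add: norm_mult)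
  also have "\<dots> < s * 1" using s by simp
  finally have "s * cmod x < s * 1" .
  hence "spectral_radius B < 1" unfolding x(2) by (rule mult_left_less_imp_less) (use s in simp)
  then obtain c where c: "\<And>k. norm_bound (B ^\<^sub>m k) c"
    using spectral_radius_jnf_norm_bound_less_1_upper_triangular[OF B] by blast
  have bound: "cmod ((A ^\<^sub>m k) $$ (i, j)) \<le> c * s ^ k" for k
  proof -
    have "cmod ((B ^\<^sub>m k) $$ (i, j)) \<le> c"
      using c[of k] ij B by (simp add: norm_bound_def)
    moreover have "(A ^\<^sub>m k) $$ (i, j) = complex_of_real s ^ k * (B ^\<^sub>m k) $$ (i, j)"
      unfolding AB smult_pow_mat[OF B] using ij B by simp
    ultimately show ?thesis
      using s by (simp add: norm_mult norm_power mult.commute mult_left_mono)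
  qed
  have "(\<lambda>k. c * s ^ k) \<longlonglongrightarrow> c * 0"
    using s by (intro tendsto_mult tendsto_const LIMSEQ_realpow_zero) auto
  hence "(\<lambda>k. c * s ^ k) \<longlonglongrightarrow> 0" by simp
  thus ?thesis by (rule Lim_null_comparison[OF eventuallyI[OF bound]])
qed

lemma real_pow_mat_tendsto_0:
  assumes A: "A \<in> carrier_mat n n" and n: "0 < n" and rad: "spectral_radius (cmat A) < 1"
    and ij: "i < n" "j < n"
  shows "(\<lambda>k. (A ^\<^sub>m k) $$ (i, j)) \<longlonglongrightarrow> 0"
proof -
  have "(\<lambda>k. (cmat A ^\<^sub>m k) $$ (i, j)) \<longlonglongrightarrow> 0"
    using pow_mat_tendsto_0[of "cmat A" n] assms by simp
  moreover have "(cmat A ^\<^sub>m k) $$ (i, j) = complex_of_real ((A ^\<^sub>m k) $$ (i, j))" for k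
    using A ij by (simp add: of_real_hom.mat_hom_pow[OF A, symmetric])
  ultimately have "(\<lambda>k. complex_of_real ((A ^\<^sub>m k) $$ (i, j))) \<longlonglongrightarrow> complex_of_real 0" by simp
  thus ?thesis by (simp only: tendsto_of_real_iff)
qed

text \<open>Iterating the hypothesis gives \<open>x' D x \<ge> y' D y\<close> with \<open>y = (G^k)' x\<close>, which tends to 0.\<close>

lemma quadratic_form_nonneg:
  fixes G D :: "real mat"
  assumes G: "G \<in> carrier_mat n n" and D: "D \<in> carrier_mat n n" and n: "0 < n"
    and rad: "spectral_radius (cmat G) < 1"
    and mono: "\<And>x. x \<in> carrier_vec n \<Longrightarrow> (G\<^sup>T *\<^sub>v x) \<bullet> (D *\<^sub>v (G\<^sup>T *\<^sub>v x)) \<le> x \<bullet> (D *\<^sub>v x)"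
    and x: "x \<in> carrier_vec n"
  shows "0 \<le> x \<bullet> (D *\<^sub>v x)"
proof -
  define y where "y k = (G ^\<^sub>m k)\<^sup>T *\<^sub>v x" for k
  have yc: "y k \<in> carrier_vec n" for k using mult_mat_vec_carrier[of "(G ^\<^sub>m k)\<^sup>T" n n x] G x by (simp add: y_def)
  have y0: "y 0 = x" using G x by (simp add: y_def)
  have ySuc: "y (Suc k) = G\<^sup>T *\<^sub>v y k" for k
  proof -
    have "(G ^\<^sub>m Suc k)\<^sup>T = G\<^sup>T * (G ^\<^sub>m k)\<^sup>T"
      using transpose_mult[OF pow_carrier_mat[OF G] G] by simp
    thus ?thesis using assoc_mult_mat_vec[of "G\<^sup>T" n n "(G ^\<^sub>m k)\<^sup>T" n x] G x
      by (simp add: y_def)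
  qed
  have le: "y k \<bullet> (D *\<^sub>v y k) \<le> x \<bullet> (D *\<^sub>v x)" for k
    by (induction k) (use mono[OF yc] in \<open>auto simp: y0 ySuc intro: order_trans\<close>)
  have lim: "(\<lambda>k. y k $ i) \<longlonglongrightarrow> 0" if "i < n" for i
  proof -
    have "y k $ i = (\<Sum>j<n. (G ^\<^sub>m k) $$ (j, i) * x $ j)" for k
      using that G x by (simp add: y_def scalar_prod_def atLeast0LessThan)
    moreover have "(\<lambda>k. \<Sum>j<n. (G ^\<^sub>m k) $$ (j, i) * x $ j) \<longlonglongrightarrow> (\<Sum>j<n. 0 * x $ j)"
      by (intro tendsto_intros real_pow_mat_tendsto_0[OF G n rad]) (use that in auto)
    ultimately show ?thesis by simp
  qed
  have "y k \<bullet> (D *\<^sub>v y k) = (\<Sum>i<n. y k $ i * (\<Sum>j<n. D $$ (i, j) * y k $ j))" for k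
    using D yc[of k] by (simp add: scalar_prod_def atLeast0LessThan)
  moreover have "(\<lambda>k. \<Sum>i<n. y k $ i * (\<Sum>j<n. D $$ (i, j) * y k $ j))
      \<longlonglongrightarrow> (\<Sum>i<n. 0 * (\<Sum>j<n. D $$ (i, j) * 0))"
    by (intro tendsto_intros lim) auto
  ultimately have "(\<lambda>k. y k \<bullet> (D *\<^sub>v y k)) \<longlonglongrightarrow> 0" by simp
  thus ?thesis by (rule LIMSEQ_le_const2) (use le in auto)
qed

lemma scalar_prod_congruence:
  fixes G D :: "'a :: comm_semiring_0 mat"
  assumes "G \<in> carrier_mat n n" "D \<in> carrier_mat n n" "x \<in> carrier_vec n"
  shows "x \<bullet> ((G * D * G\<^sup>T) *\<^sub>v x) = (G\<^sup>T *\<^sub>v x) \<bullet> (D *\<^sub>v (G\<^sup>T *\<^sub>v x))"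
proof -
  have "(G * D * G\<^sup>T) *\<^sub>v x = G *\<^sub>v (D *\<^sub>v (G\<^sup>T *\<^sub>v x))"
    using assms by (simp add: assoc_mult_mat_vec[of _ n n _ n])
  moreover have "x \<bullet> (G *\<^sub>v y) = (G\<^sup>T *\<^sub>v x) \<bullet> y" if "y \<in> carrier_vec n" for y
    using assms that transpose_vec_mult_scalar[of G n n y x]
    by (simp add: comm_scalar_prod[of _ n])
  ultimately show ?thesis using assms by simp
qed

lemma scalar_prod_outer_prod:
  fixes v :: "'a :: comm_semiring_0 vec"
  assumes "v \<in> carrier_vec n" "x \<in> carrier_vec n"
  shows "x \<bullet> (outer_prod v v *\<^sub>v x) = (v \<bullet> x) * (v \<bullet> x)"
proof -
  have "outer_prod v v *\<^sub>v x = (v \<bullet> x) \<cdot>\<^sub>v v"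
    using assms by (intro eq_vecI)
      (auto simp: scalar_prod_def outer_prod_def sum_distrib_left sum_distrib_right mult_ac)
  thus ?thesis using assms by (simp add: comm_scalar_prod[of x n v])
qed

lemma lyapunov_solution_nonneg:
  fixes G D :: "real mat"
  assumes G: "G \<in> carrier_mat n n" and D: "D \<in> carrier_mat n n" and n: "0 < n"
    and rad: "spectral_radius (cmat G) < 1"
    and v: "v \<in> carrier_vec n" and "0 \<le> c"
    and eq: "D = G * D * G\<^sup>T + c \<cdot>\<^sub>m outer_prod v v"
    and x: "x \<in> carrier_vec n"
  shows "0 \<le> x \<bullet> (D *\<^sub>v x)"
proof (rule quadratic_form_nonneg[OF G D n rad _ x])
  fix x :: "real vec" assume x: "x \<in> carrier_vec n"
  have GDG: "G * D * G\<^sup>T \<in> carrier_mat n n" using G D by auto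
  have "x \<bullet> (D *\<^sub>v x) = x \<bullet> ((G * D * G\<^sup>T + c \<cdot>\<^sub>m outer_prod v v) *\<^sub>v x)"
    using eq by simp
  also have "(G * D * G\<^sup>T + c \<cdot>\<^sub>m outer_prod v v) *\<^sub>v x
      = (G * D * G\<^sup>T) *\<^sub>v x + c \<cdot>\<^sub>v (outer_prod v v *\<^sub>v x)"
    using GDG v x by (subst add_mult_distrib_mat_vec[of _ n n])
      (auto simp: smult_mat_mult_vec[of _ n n])
  also have "x \<bullet> \<dots> = x \<bullet> ((G * D * G\<^sup>T) *\<^sub>v x) + c * (x \<bullet> (outer_prod v v *\<^sub>v x))"
    using GDG v x by (subst scalar_prod_add_distrib[of _ n])
      (auto intro!: mult_mat_vec_carrier[of _ n n])
  also have "\<dots> = (G\<^sup>T *\<^sub>v x) \<bullet> (D *\<^sub>v (G\<^sup>T *\<^sub>v x)) + c * (v \<bullet> x)\<^sup>2"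
    unfolding scalar_prod_congruence[OF G D x] scalar_prod_outer_prod[OF v x]
    by (simp add: power2_eq_square)
  finally show "(G\<^sup>T *\<^sub>v x) \<bullet> (D *\<^sub>v (G\<^sup>T *\<^sub>v x)) \<le> x \<bullet> (D *\<^sub>v x)"
    using \<open>0 \<le> c\<close> by simp
qed

section \<open>Diagonal sums of a bilinear form\<close>

text \<open>The partial sum of \<open>r\<close> along a diagonal, from the border down to \<open>(i, j)\<close>; these sums are the
  coefficients of the power series \<open>(\<Sum> r i j x^i y^j) / (1 - x y)\<close>. For \<open>i = n\<close> it runs along the whole
  diagonal of an \<open>(n+1) \<times> (n+1)\<close> array.\<close>

definition diag_sum :: "(nat \<Rightarrow> nat \<Rightarrow> 'a :: comm_monoid_add) \<Rightarrow> nat \<Rightarrow> nat \<Rightarrow> 'a" where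
  "diag_sum r i j = (\<Sum>l\<le>min i j. r (i - l) (j - l))"

lemma diag_sum_Suc: "diag_sum r (Suc i) (Suc j) = r (Suc i) (Suc j) + diag_sum r i j"
  unfolding diag_sum_def min_Suc_Suc sum.atMost_Suc_shift by simp

lemma diag_sum_0 [simp]: "diag_sum r 0 j = r 0 j" "diag_sum r i 0 = r i 0"
  by (simp_all add: diag_sum_def)

lemma diag_sum_sym:
  assumes "\<And>i j. r i j = r j i"
  shows "diag_sum r i j = diag_sum r j i"
  unfolding diag_sum_def using assms by (intro sum.cong) auto

text \<open>With \<open>y = 1/x\<close> the monomial with coefficient \<open>r i j\<close> becomes \<open>x^(j-i)\<close>, so that vanishing of the form on
  \<open>x y = 1\<close> means that the sums along the diagonals vanish.\<close>

lemma diag_sum_zero: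
  fixes r :: "nat \<Rightarrow> nat \<Rightarrow> complex"
  assumes "infinite Z"
    and vanish: "\<And>x. x \<in> Z \<Longrightarrow> x \<noteq> 0 \<and>
      (\<Sum>i\<le>n. \<Sum>j\<le>n. r i j * (x ^ (n - i) * inverse x ^ (n - j))) = 0"
    and "m \<le> n"
  shows "diag_sum r n m = 0"
proof -
  define p where "p = (\<Sum>i\<le>n. \<Sum>j\<le>n. monom (r i j) (n - i + j))"
  have "poly p x = 0" if "x \<in> Z" for x
  proof -
    have x: "x \<noteq> 0" using vanish[OF that] by simp
    have "poly p x = (\<Sum>i\<le>n. \<Sum>j\<le>n. r i j * x ^ (n - i + j))"
      by (simp add: p_def poly_sum poly_monom)
    also have "\<dots> = (\<Sum>i\<le>n. \<Sum>j\<le>n. x ^ n * (r i j * (x ^ (n - i) * inverse x ^ (n - j))))"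
    proof (intro sum.cong refl)
      fix i j assume "i \<in> {..n}" "j \<in> {..n}"
      hence "x ^ n = x ^ j * x ^ (n - j)" by (simp flip: power_add)
      hence "x ^ n * inverse x ^ (n - j) = x ^ j"
        using x by (simp add: power_inverse field_simps)
      thus "r i j * x ^ (n - i + j) = x ^ n * (r i j * (x ^ (n - i) * inverse x ^ (n - j)))"
        by (simp add: power_add mult_ac)
    qed
    also have "\<dots> = x ^ n * (\<Sum>i\<le>n. \<Sum>j\<le>n. r i j * (x ^ (n - i) * inverse x ^ (n - j)))"
      by (simp add: sum_distrib_left)
    finally show ?thesis using vanish[OF that] by simp
  qed
  hence "infinite {x. poly p x = 0}"
    using assms(1) by (metis (mono_tags, lifting) finite_subset mem_Collect_eq subsetI)
  hence "p = 0" using poly_roots_finite by blast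
  hence "0 = (\<Sum>i\<le>n. \<Sum>j\<le>n. if n - i + j = m then r i j else 0)"
    using arg_cong[of p 0 "\<lambda>p. coeff p m"] unfolding p_def coeff_sum by simp
  also have "\<dots> = (\<Sum>i\<le>n. if n - i \<le> m then r i (m - (n - i)) else 0)"
  proof (intro sum.cong refl)
    fix i assume "i \<in> {..n}"
    have "(\<Sum>j\<le>n. if n - i + j = m then r i j else 0)
        = (\<Sum>j\<le>n. if j = m - (n - i) then (if n - i \<le> m then r i j else 0) else 0)"
      by (intro sum.cong) auto
    thus "(\<Sum>j\<le>n. if n - i + j = m then r i j else 0)
        = (if n - i \<le> m then r i (m - (n - i)) else 0)"
      using \<open>m \<le> n\<close> by simp
  qed
  also have "\<dots> = (\<Sum>l\<le>n. if l \<le> m then r (n - l) (m - l) else 0)"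
    by (rule sum.reindex_bij_witness[of _ "\<lambda>l. n - l" "\<lambda>l. n - l"]) auto
  also have "\<dots> = (\<Sum>l\<in>{..m}. r (n - l) (m - l))"
    using \<open>m \<le> n\<close> by (subst sum.inter_filter[symmetric]) (auto intro!: sum.cong)
  finally show ?thesis using \<open>m \<le> n\<close> by (simp add: diag_sum_def)
qed


text \<open>The coefficients of \<open>\<rho>\<^sup>2 \<sigma>(x) \<sigma>(y) - (a(x) b(y) + b(x) a(y)) / 2\<close>, which vanishes on \<open>x y = 1\<close> exactly when
  \<open>f(x) + f(1/x) = w(x) w(1/x)\<close>. Here index 0 belongs to the leading coefficient.\<close>

definition spectral_form :: "real \<Rightarrow> real vec \<Rightarrow> real vec \<Rightarrow> real vec \<Rightarrow> nat \<Rightarrow> nat \<Rightarrow> real" where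
  "spectral_form \<rho> \<sigma> a b i j = \<rho>\<^sup>2 * (vCons 1 \<sigma> $ i * vCons 1 \<sigma> $ j)
     - (vCons 1 a $ i * vCons 1 b $ j + vCons 1 b $ i * vCons 1 a $ j) / 2"

lemma spectral_form_sym: "spectral_form \<rho> \<sigma> a b i j = spectral_form \<rho> \<sigma> a b j i"
  by (simp add: spectral_form_def algebra_simps)

section \<open>Congruences by companion matrices and Riccati solutions\<close>

lemma padded_minus:
  fixes A B :: "'a :: group_add mat"
  assumes "A \<in> carrier_mat n n" "B \<in> carrier_mat n n"
  shows "padded n (A - B) i j = padded n A i j - padded n B i j"
  using assms by (simp add: padded_def)

lemma companion_congruence_minus:
  assumes v: "v \<in> carrier_vec n" and A: "A \<in> carrier_mat n n" and B: "B \<in> carrier_mat n n"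
    and ij: "i < n" "j < n"
  shows "(companion v * (A - B) * (companion v)\<^sup>T) $$ (i, j)
    = (companion v * A * (companion v)\<^sup>T) $$ (i, j) - (companion v * B * (companion v)\<^sup>T) $$ (i, j)"
proof -
  have AB: "A - B \<in> carrier_mat n n" using B by (rule minus_carrier_mat)
  have "(A - B) $$ (0, 0) = A $$ (0, 0) - B $$ (0, 0)" using B ij by simp
  thus ?thesis
    unfolding companion_congruence[OF v AB ij] companion_congruence[OF v A ij]
      companion_congruence[OF v B ij] padded_minus[OF A B] \<open>(A - B) $$ (0, 0) = _\<close>
    by (simp add: algebra_simps)
qed

lemma padded_sym: "X \<in> carrier_mat n n \<Longrightarrow> X\<^sup>T = X \<Longrightarrow> padded n X i j = padded n X j i"
  by (metis padded_def carrier_matD index_transpose_mat(1))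

lemma companion_mult_first_col:
  assumes "v \<in> carrier_vec n" "X \<in> carrier_mat n n" "i < n"
  shows "(companion v *\<^sub>v (X *\<^sub>v h_vec n)) $ i = padded n X (Suc i) 0 - v $ i * X $$ (0, 0)"
proof -
  have n: "0 < n" using assms(3) by simp
  hence col: "col X 0 \<in> carrier_vec n" using assms(2) by auto
  show ?thesis
    unfolding mult_h_vec[OF assms(2) n] companion_mult_vec[OF col assms(1,3)]
    using assms n by (simp add: padded_def)
qed

lemma h_quadratic_form:
  fixes X :: "'a :: comm_semiring_1 mat"
  assumes "X \<in> carrier_mat n n" "0 < n"
  shows "h_vec n \<bullet> (X *\<^sub>v h_vec n) = X $$ (0, 0)"
  using assms by (simp add: mult_h_vec)

text \<open>\<open>\<Gamma>\<close> and \<open>F\<close> differ by the rank-one matrix \<open>(\<sigma> - a) h'\<close>; this transfers every statement about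
  \<open>F X F'\<close> to \<open>\<Gamma> X \<Gamma>'\<close>.\<close>

lemma companion_congruence_change:
  assumes "a \<in> carrier_vec n" "\<sigma> \<in> carrier_vec n" "X \<in> carrier_mat n n" "X\<^sup>T = X"
    and "s = companion a *\<^sub>v (X *\<^sub>v h_vec n)" "k = \<sigma> - a" "i < n" "j < n"
  shows "(companion \<sigma> * X * (companion \<sigma>)\<^sup>T) $$ (i, j)
    = (companion a * X * (companion a)\<^sup>T) $$ (i, j)
      - k $ i * s $ j - s $ i * k $ j + X $$ (0, 0) * (k $ i * k $ j)"
proof -
  have s: "s $ i = padded n X (Suc i) 0 - a $ i * X $$ (0, 0)"
    "s $ j = padded n X (Suc j) 0 - a $ j * X $$ (0, 0)"
    unfolding assms(5) by (rule companion_mult_first_col[OF assms(1,3)] assms)+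
  have k: "\<sigma> $ i = a $ i + k $ i" "\<sigma> $ j = a $ j + k $ j"
    using assms by auto
  show ?thesis
    unfolding companion_congruence[OF assms(1,3,7,8)] companion_congruence[OF assms(2,3,7,8)] s k
      padded_sym[OF assms(3,4), of 0 "Suc j"]
    by (simp add: algebra_simps)
qed

lemma mult_outer_prod_h:
  fixes X :: "real mat"
  assumes "X \<in> carrier_mat n n" "0 < n" "i < n" "j < n"
  shows "(X * outer_prod (h_vec n) (h_vec n) * X) $$ (i, j) = X $$ (i, 0) * X $$ (0, j)"
proof -
  have "(X * outer_prod (h_vec n) (h_vec n)) $$ (i, l) = (if l = 0 then X $$ (i, 0) else 0)"
    if "l < n" for l
  proof -
    have "(X * outer_prod (h_vec n) (h_vec n)) $$ (i, l)
        = (\<Sum>m<n. if m = 0 then (if l = 0 then X $$ (i, 0) else 0) else 0)"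
    proof -
      have "(X * outer_prod (h_vec n) (h_vec n)) $$ (i, l)
          = (\<Sum>m<n. X $$ (i, m) * ((if m = 0 then 1 else 0) * (if l = 0 then 1 else 0)))"
        using assms that by (simp add: scalar_prod_def atLeast0LessThan)
      also have "\<dots> = (\<Sum>m<n. if m = 0 then (if l = 0 then X $$ (i, 0) else 0) else 0)"
        by (intro sum.cong) auto
      finally show ?thesis .
    qed
    thus ?thesis using assms(2) by simp
  qed
  note left = this
  have "(X * outer_prod (h_vec n) (h_vec n) * X) $$ (i, j)
      = (\<Sum>l<n. (X * outer_prod (h_vec n) (h_vec n)) $$ (i, l) * X $$ (l, j))"
    using assms by (simp add: scalar_prod_def atLeast0LessThan)
  also have "\<dots> = (\<Sum>l<n. if l = 0 then X $$ (i, 0) * X $$ (0, j) else 0)"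
    by (intro sum.cong refl) (simp add: left del: index_mult_mat(1))
  finally show ?thesis using assms(2) by simp
qed

lemma riccati_solution_entry:
  assumes "riccati_solution n F g P" "F \<in> carrier_mat n n" "g \<in> carrier_vec n" "0 < n"
    and "s = F *\<^sub>v (P *\<^sub>v h_vec n)" "i < n" "j < n"
  shows "P $$ (i, j) = (F * P * F\<^sup>T) $$ (i, j)
           + inverse (1 - P $$ (0, 0)) * ((g $ i - s $ i) * (g $ j - s $ j))"
proof -
  have P: "P \<in> carrier_mat n n" using assms(1) by (simp add: riccati_solution_def)
  have "P = F * P * F\<^sup>T + inverse (1 - P $$ (0, 0)) \<cdot>\<^sub>m outer_prod (g - s) (g - s)"
    using assms(1) unfolding riccati_solution_def assms(5) h_quadratic_form[OF P assms(4)] by blast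
  moreover have "s \<in> carrier_vec n" unfolding assms(5) using assms(2) by (rule mult_mat_vec_in_carrier)
  hence "(F * P * F\<^sup>T + inverse (1 - P $$ (0, 0)) \<cdot>\<^sub>m outer_prod (g - s) (g - s)) $$ (i, j)
      = (F * P * F\<^sup>T) $$ (i, j) + inverse (1 - P $$ (0, 0)) * ((g $ i - s $ i) * (g $ j - s $ j))"
    using assms(2,3,6,7) by (simp del: index_mult_mat(1))
  ultimately show ?thesis by simp
qed

section \<open>The Riccati solution belonging to the spectral factor\<close>

locale spectral_data =
  fixes n :: nat and a b \<sigma> g :: "real vec" and \<rho> :: real
  assumes n: "0 < n"
    and a: "a \<in> carrier_vec n" and b: "b \<in> carrier_vec n" and \<sigma>: "\<sigma> \<in> carrier_vec n"
    and g: "g \<in> carrier_vec n" and gi: "\<And>i. i < n \<Longrightarrow> g $ i = (b $ i - a $ i) / 2"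
    and diag0: "\<And>m. m \<le> n \<Longrightarrow> diag_sum (spectral_form \<rho> \<sigma> a b) n m = 0"
    and \<rho>: "\<rho> > 0"
begin

abbreviation "r \<equiv> spectral_form \<rho> \<sigma> a b"

text \<open>\<open>M(i, j)\<close> is the coefficient of \<open>x^(n-1-i) y^(n-1-j)\<close> in the polynomial \<open>r(x, y) / (1 - x y)\<close>,
  a relative of the Bezoutian. The full diagonal sums vanish, so the recursion \<open>M(i+1, j+1) = M(i, j) - r(i+1, j+1)\<close>
  remains valid when it leaves the matrix, where the entries are 0. Everything below rests on this.\<close>

definition "M = mat n n (\<lambda>(i, j). - diag_sum r i j)"

text \<open>Since \<open>w(x) = \<rho> (1 + k(x) / a(x))\<close>, this is the gain of the spectral factor \<open>w\<close>.\<close>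

definition "k = \<sigma> - a"

lemma M [simp]: "M \<in> carrier_mat n n" and k: "k \<in> carrier_vec n"
  using a \<sigma> by (auto simp: M_def k_def)

lemma F_mult_carrier: "companion a *\<^sub>v x \<in> carrier_vec n"
  by (rule mult_mat_vec_in_carrier[OF companion_carrier[OF a]])

lemma padded_M:
  assumes "i \<le> n" "j \<le> n"
  shows "padded n M i j = - diag_sum r i j"
  using assms diag0[of j] diag0[of i] diag_sum_sym[of r i j, OF spectral_form_sym]
  by (cases "i = n"; cases "j = n") (auto simp: padded_def M_def)

lemma M_sym: "M\<^sup>T = M"
  using diag_sum_sym[of r, OF spectral_form_sym] by (intro eq_matI) (auto simp: M_def)

lemma M00: "M $$ (0, 0) = 1 - \<rho>\<^sup>2"
  using n by (simp add: M_def spectral_form_def)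

text \<open>By the recursion for \<open>M\<close>, the left-hand side is \<open>M(i, j)\<close> minus the bilinear form \<open>r\<close> applied to the
  rows \<open>e(i+1) - a(i+1) e(0)\<close> and \<open>e(j+1) - a(j+1) e(0)\<close>. The part of \<open>r\<close> that involves \<open>a\<close> vanishes on
  these, and the part with \<open>\<sigma>\<close> leaves \<open>\<rho>\<^sup>2 k k'\<close>.\<close>

lemma F_congruence_M:
  assumes "i < n" "j < n"
  shows "(companion a * M * (companion a)\<^sup>T) $$ (i, j) = M $$ (i, j) - \<rho>\<^sup>2 * (k $ i * k $ j)"
proof -
  have Mij: "M $$ (i, j) = - diag_sum r i j" using assms by (simp add: M_def)
  show ?thesis
    unfolding companion_congruence[OF a M assms] Mij
    using assms a \<sigma> n
    by (simp add: padded_M diag_sum_Suc M00 k_def)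
      (simp add: spectral_form_def algebra_simps power2_eq_square field_simps)
qed

lemma F_M_h:
  assumes "i < n"
  shows "(companion a *\<^sub>v (M *\<^sub>v h_vec n)) $ i = g $ i - \<rho>\<^sup>2 * k $ i"
  unfolding companion_mult_first_col[OF a M assms] using assms a \<sigma> n
  by (simp add: padded_M k_def gi M00) (simp add: spectral_form_def algebra_simps field_simps)

lemma Gamma_M_h:
  assumes "i < n"
  shows "(companion \<sigma> *\<^sub>v (M *\<^sub>v h_vec n)) $ i = g $ i - k $ i"
proof -
  have "(companion \<sigma> *\<^sub>v (M *\<^sub>v h_vec n)) $ i = (companion a *\<^sub>v (M *\<^sub>v h_vec n)) $ i - k $ i * M $$ (0, 0)"
    unfolding companion_mult_first_col[OF a M assms] companion_mult_first_col[OF \<sigma> M assms]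
    using assms a \<sigma> by (simp add: k_def algebra_simps)
  thus ?thesis unfolding F_M_h[OF assms] M00 by (simp add: algebra_simps)
qed

lemma Gamma_congruence_M:
  assumes "i < n" "j < n"
  shows "(companion \<sigma> * M * (companion \<sigma>)\<^sup>T) $$ (i, j)
         = M $$ (i, j) + k $ i * k $ j - k $ i * g $ j - g $ i * k $ j"
  unfolding companion_congruence_change[OF a \<sigma> M M_sym refl k_def assms] F_congruence_M[OF assms]
    F_M_h[OF assms(1)] F_M_h[OF assms(2)] M00
  by (simp add: algebra_simps)

lemma riccati_solution_M: "riccati_solution n (companion a) g M"
proof -
  have "M = companion a * M * (companion a)\<^sup>T + inverse (\<rho>\<^sup>2) \<cdot>\<^sub>m
      outer_prod (g - companion a *\<^sub>v (M *\<^sub>v h_vec n)) (g - companion a *\<^sub>v (M *\<^sub>v h_vec n))"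
    (is "M = ?R")
  proof (rule eq_matI)
    fix i j assume "i < dim_row ?R" "j < dim_col ?R"
    hence ij: "i < n" "j < n" using a by auto
    have eq: "M $$ (i, j) = (companion a * M * (companion a)\<^sup>T) $$ (i, j)
        + inverse (\<rho>\<^sup>2) * ((\<rho>\<^sup>2 * k $ i) * (\<rho>\<^sup>2 * k $ j))"
      unfolding F_congruence_M[OF ij] using \<rho> by (simp add: field_simps)
    have "(g - companion a *\<^sub>v (M *\<^sub>v h_vec n)) $ i = \<rho>\<^sup>2 * k $ i"
      "(g - companion a *\<^sub>v (M *\<^sub>v h_vec n)) $ j = \<rho>\<^sup>2 * k $ j"
      using ij a F_M_h[of i] F_M_h[of j] by (auto simp del: index_mult_mat_vec)
    moreover have "?R $$ (i, j) = (companion a * M * (companion a)\<^sup>T) $$ (i, j) + inverse (\<rho>\<^sup>2) *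
        ((g - companion a *\<^sub>v (M *\<^sub>v h_vec n)) $ i * (g - companion a *\<^sub>v (M *\<^sub>v h_vec n)) $ j)"
      using ij a g F_mult_carrier[of "M *\<^sub>v h_vec n"]
      by (subst index_add_mat) (auto simp del: index_mult_mat(1) index_mult_mat_vec index_minus_vec(1))
    ultimately show "M $$ (i, j) = ?R $$ (i, j)" unfolding eq by simp
  qed (use a in \<open>auto simp: M_def\<close>)
  thus ?thesis
    using \<rho> n by (simp add: riccati_solution_def M_sym h_quadratic_form[OF M n] M00)
qed

text \<open>Completing the square in the gain: for every solution, \<open>P - \<Gamma> P \<Gamma>'\<close> is \<open>g k' + k g' - k k'\<close>, which is
  also \<open>M - \<Gamma> M \<Gamma>'\<close>, plus a rank-one matrix that measures how far the gain of \<open>P\<close> is from \<open>k\<close>.\<close>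

lemma riccati_difference:
  assumes P: "riccati_solution n (companion a) g P"
    and y: "y = g - companion a *\<^sub>v (P *\<^sub>v h_vec n) - (1 - P $$ (0, 0)) \<cdot>\<^sub>v k"
    and ij: "i < n" "j < n"
  shows "(companion \<sigma> * (P - M) * (companion \<sigma>)\<^sup>T) $$ (i, j)
         = (P - M) $$ (i, j) - inverse (1 - P $$ (0, 0)) * (y $ i * y $ j)"
proof -
  define s where "s = companion a *\<^sub>v (P *\<^sub>v h_vec n)"
  define c where "c = 1 - P $$ (0, 0)"
  have Pc: "P \<in> carrier_mat n n" and Ps: "P\<^sup>T = P" and c0: "c \<noteq> 0"
    using P h_quadratic_form[of P n] n by (auto simp: riccati_solution_def c_def)
  have s: "s \<in> carrier_vec n" unfolding s_def by (rule F_mult_carrier)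
  have yi: "y $ l = (g $ l - s $ l) - c * k $ l" if "l < n" for l
    using that g s k by (simp add: y s_def[symmetric] c_def)
  have "(companion \<sigma> * (P - M) * (companion \<sigma>)\<^sup>T) $$ (i, j)
      = (companion \<sigma> * P * (companion \<sigma>)\<^sup>T) $$ (i, j) - (companion \<sigma> * M * (companion \<sigma>)\<^sup>T) $$ (i, j)"
    by (rule companion_congruence_minus[OF \<sigma> Pc M ij])
  also have "\<dots> = (P $$ (i, j) - inverse c * ((g $ i - s $ i) * (g $ j - s $ j))
      - k $ i * s $ j - s $ i * k $ j + (1 - c) * (k $ i * k $ j))
      - (M $$ (i, j) + k $ i * k $ j - k $ i * g $ j - g $ i * k $ j)"
    unfolding Gamma_congruence_M[OF ij] companion_congruence_change[OF a \<sigma> Pc Ps s_def k_def ij]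
    using riccati_solution_entry[OF P _ g n s_def ij] a by (simp add: c_def)
  also have "\<dots> = (P $$ (i, j) - M $$ (i, j)) - inverse c * (y $ i * y $ j)"
    unfolding yi[OF ij(1)] yi[OF ij(2)] using c0 by (simp add: field_simps)
  finally show ?thesis using Pc ij carrier_matD[OF M] by (simp add: c_def)
qed

text \<open>The difference \<open>P - M\<close> solves a Lyapunov equation for the stable matrix \<open>\<Gamma>\<close> and is semidefinite with
  the sign of \<open>1 - h'Ph\<close>. A negative sign is absurd: it gives \<open>P \<le> M\<close>, hence
  \<open>h'Ph \<le> h'Mh = 1 - \<rho>\<^sup>2 < 1\<close>.\<close>

lemma M_minimum:
  assumes P: "riccati_solution n (companion a) g P" and schur: "schur_poly (monic_poly \<sigma>)"
  shows "loewner_le n M P"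
proof -
  define y where "y = g - companion a *\<^sub>v (P *\<^sub>v h_vec n) - (1 - P $$ (0, 0)) \<cdot>\<^sub>v k"
  define c where "c = 1 - P $$ (0, 0)"
  have Pc: "P \<in> carrier_mat n n" and c0: "c \<noteq> 0"
    using P h_quadratic_form[of P n] n by (auto simp: riccati_solution_def c_def)
  have y: "y \<in> carrier_vec n" unfolding y_def using g k F_mult_carrier by (intro minus_carrier_vec smult_carrier_vec) auto
  have G: "companion \<sigma> \<in> carrier_mat n n" using \<sigma> by simp
  note nonneg = lyapunov_solution_nonneg[OF G _ n spectral_radius_companion_less_1[OF \<sigma> n schur] y]
  note diff = riccati_difference[OF P y_def]
  have PM: "P - M = companion \<sigma> * (P - M) * (companion \<sigma>)\<^sup>T + inverse c \<cdot>\<^sub>m outer_prod y y"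
    using y \<sigma> Pc diff
    by (intro eq_matI) (simp_all add: c_def del: index_mult_mat(1) index_minus_mat(1), simp_all add: M_def)
  have MP: "M - P = companion \<sigma> * (M - P) * (companion \<sigma>)\<^sup>T + (- inverse c) \<cdot>\<^sub>m outer_prod y y"
  proof (rule eq_matI)
    fix i j assume "i < dim_row (companion \<sigma> * (M - P) * (companion \<sigma>)\<^sup>T + (- inverse c) \<cdot>\<^sub>m outer_prod y y)"
      "j < dim_col (companion \<sigma> * (M - P) * (companion \<sigma>)\<^sup>T + (- inverse c) \<cdot>\<^sub>m outer_prod y y)"
    hence ij: "i < n" "j < n" using y by auto
    have "(companion \<sigma> * (M - P) * (companion \<sigma>)\<^sup>T) $$ (i, j)
        = - (companion \<sigma> * (P - M) * (companion \<sigma>)\<^sup>T) $$ (i, j)"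
      unfolding companion_congruence_minus[OF \<sigma> Pc M ij] companion_congruence_minus[OF \<sigma> M Pc ij]
      by simp
    thus "(M - P) $$ (i, j) = (companion \<sigma> * (M - P) * (companion \<sigma>)\<^sup>T
        + (- inverse c) \<cdot>\<^sub>m outer_prod y y) $$ (i, j)"
      using diff[OF ij] ij y \<sigma> Pc carrier_matD[OF M] by (simp add: c_def del: index_mult_mat(1))
  qed (use y Pc in auto)
  \<comment> \<open>Testing \<open>M - P \<ge> 0\<close> on \<open>h\<close> rules out the negative sign.\<close>
  have "c > 0"
  proof (rule ccontr)
    assume "\<not> c > 0"
    hence "0 \<le> - inverse c" using c0 by simp
    from nonneg[OF _ this MP, of "h_vec n"]
    have "0 \<le> (M - P) $$ (0, 0)"
      using Pc h_quadratic_form[of "M - P" n] n by (simp add: minus_carrier_mat)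
    hence "\<rho>\<^sup>2 \<le> c" using Pc n by (simp add: M00 c_def)
    moreover have "\<rho>\<^sup>2 > 0" using \<rho> by simp
    ultimately show False using \<open>\<not> c > 0\<close> by simp
  qed
  hence "0 \<le> inverse c" by simp
  from nonneg[OF _ this PM] show ?thesis
    by (simp add: loewner_le_def minus_carrier_mat)
qed

lemma minimal_eq_M:
  assumes "minimal_riccati_solution n (companion a) g P" "schur_poly (monic_poly \<sigma>)"
  shows "P = M"
  using assms M_minimum riccati_solution_M unfolding minimal_riccati_solution_def by blast

lemma covariance_extension_equation:
  "M = companion \<sigma> * (M - M * outer_prod (h_vec n) (h_vec n) * M) * (companion \<sigma>)\<^sup>T + outer_prod g g"
proof (rule eq_matI)
  let ?N = "M * outer_prod (h_vec n) (h_vec n) * M"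
  let ?R = "companion \<sigma> * (M - ?N) * (companion \<sigma>)\<^sup>T + outer_prod g g"
  fix i j assume "i < dim_row ?R" "j < dim_col ?R"
  hence ij: "i < n" "j < n" using g by auto
  have N: "?N \<in> carrier_mat n n" by (intro mult_carrier_mat[of _ n n]) auto
  have paddedN: "padded n ?N i j = padded n M i 0 * padded n M j 0" for i j
    using n mult_outer_prod_h[OF M n, of i j] padded_sym[OF M M_sym, of 0 j]
    by (auto simp: padded_def simp del: index_mult_mat(1))
  have N00: "?N $$ (0, 0) = M $$ (0, 0) * M $$ (0, 0)"
    by (rule mult_outer_prod_h[OF M n n n])
  define t where "t = companion \<sigma> *\<^sub>v (M *\<^sub>v h_vec n)"
  have t: "t $ l = padded n M (Suc l) 0 - \<sigma> $ l * M $$ (0, 0)" if "l < n" for l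
    unfolding t_def by (rule companion_mult_first_col[OF \<sigma> M that])
  have "(companion \<sigma> * ?N * (companion \<sigma>)\<^sup>T) $$ (i, j) = t $ i * t $ j"
    unfolding companion_congruence[OF \<sigma> N ij] paddedN N00 t[OF ij(1)] t[OF ij(2)]
    using n by (simp add: padded_def algebra_simps)
  also have "\<dots> = (g $ i - k $ i) * (g $ j - k $ j)"
    unfolding t_def using Gamma_M_h ij by simp
  finally have GNG: "(companion \<sigma> * ?N * (companion \<sigma>)\<^sup>T) $$ (i, j) = (g $ i - k $ i) * (g $ j - k $ j)" .
  have "(companion \<sigma> * (M - ?N) * (companion \<sigma>)\<^sup>T) $$ (i, j)
      = (companion \<sigma> * M * (companion \<sigma>)\<^sup>T) $$ (i, j) - (companion \<sigma> * ?N * (companion \<sigma>)\<^sup>T) $$ (i, j)"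
    by (rule companion_congruence_minus[OF \<sigma> M N ij])
  thus "M $$ (i, j) = ?R $$ (i, j)"
    unfolding GNG Gamma_congruence_M[OF ij] using ij g \<sigma> by (simp add: algebra_simps del: index_mult_mat(1))
qed (use g in \<open>auto simp: M_def\<close>)

lemma Gamma_M_h_plus_sigma: "companion \<sigma> *\<^sub>v (M *\<^sub>v h_vec n) + \<sigma> = a + g"
  using a g \<sigma> Gamma_M_h by (intro eq_vecI) (auto simp: k_def simp del: index_mult_mat_vec)

lemma rho_eq: "\<rho> = sqrt (1 - h_vec n \<bullet> (M *\<^sub>v h_vec n))"
  using \<rho> by (simp add: h_quadratic_form[OF M n] M00)

end

section \<open>From rational identities to coefficients\<close>

lemma infinite_poly_nonzero:
  fixes p :: "complex poly"
  assumes "p \<noteq> 0"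
  shows "infinite {x. x \<noteq> 0 \<and> poly p x \<noteq> 0 \<and> poly p (inverse x) \<noteq> 0}"
proof
  assume fin: "finite {x. x \<noteq> 0 \<and> poly p x \<noteq> 0 \<and> poly p (inverse x) \<noteq> 0}"
  have "finite {x. poly p x = 0}" using assms by (rule poly_roots_finite)
  hence "finite ({0} \<union> {x. poly p x = 0} \<union> inverse ` {x. poly p x = 0}
      \<union> {x. x \<noteq> 0 \<and> poly p x \<noteq> 0 \<and> poly p (inverse x) \<noteq> 0})"
    using fin by simp
  also have "{0} \<union> {x. poly p x = 0} \<union> inverse ` {x. poly p x = 0}
      \<union> {x. x \<noteq> 0 \<and> poly p x \<noteq> 0 \<and> poly p (inverse x) \<noteq> 0} = UNIV"
    by (auto simp: image_iff) (metis inverse_inverse_eq)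
  finally show False using infinite_UNIV_char_0 by blast
qed

lemma cpoly_monic_poly_nonzero: "cpoly (monic_poly v) \<noteq> 0"
proof -
  have "coeff (monic_poly v) (dim_vec v) = 1"
    by (auto simp: monic_poly_def coeff_sum intro!: sum.neutral)
  hence "coeff (cpoly (monic_poly v)) (dim_vec v) = 1" by (simp add: coeff_map_poly)
  thus ?thesis by auto
qed

lemma companion_resolvent:
  assumes v: "v \<in> carrier_vec n" and g: "g \<in> carrier_vec n" and n: "0 < n"
    and x: "poly (cpoly (monic_poly v)) x \<noteq> 0"
  shows "poly (cpoly (monic_poly v)) x
      * (h_vec n \<bullet> (mat_inv (x \<cdot>\<^sub>m 1\<^sub>m n - cmat (companion v)) *\<^sub>v g))
    = (\<Sum>i<n. x ^ (n - Suc i) * g $ i)"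
proof -
  define A where "A = x \<cdot>\<^sub>m 1\<^sub>m n - cmat (companion v)"
  have A: "A \<in> carrier_mat n n" using v by (simp add: A_def minus_carrier_mat)
  have Ay: "A *\<^sub>v y = x \<cdot>\<^sub>v y - cmat (companion v) *\<^sub>v y" if "y \<in> carrier_vec n" for y
    using v that unfolding A_def
    by (subst minus_mult_distrib_mat_vec[of _ n n]) (auto simp: smult_mat_mult_vec[of _ n n])
  have ker: "y = 0\<^sub>v n" if y: "y \<in> carrier_vec n" and "A *\<^sub>v y = 0\<^sub>v n" for y
  proof (rule companion_kernel[OF v y x], rule eq_vecI)
    fix i assume "i < dim_vec (x \<cdot>\<^sub>v y)"
    thus "(cmat (companion v) *\<^sub>v y) $ i = (x \<cdot>\<^sub>v y) $ i"
      using arg_cong[OF that(2), of "\<lambda>w. w $ i"] y v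
      by (simp add: Ay del: index_mult_mat_vec)
  qed (use v y in auto)
  note inv = mat_inv_of_trivial_kernel[OF A ker]
  define y where "y = mat_inv A *\<^sub>v g"
  have y: "y \<in> carrier_vec n" unfolding y_def using inv(1) by (rule mult_mat_vec_in_carrier)
  have "A *\<^sub>v y = g"
    unfolding y_def using assoc_mult_mat_vec[OF A inv(1) g] inv(2) g by simp
  hence gi: "g $ i = x * y $ i - (cmat (companion v) *\<^sub>v y) $ i" if "i < n" for i
    using that y v by (auto simp: Ay simp del: index_mult_mat_vec)
  have "(\<Sum>i<n. x ^ (n - Suc i) * g $ i)
      = (\<Sum>i<n. x ^ (n - Suc i) * (x * y $ i - (cmat (companion v) *\<^sub>v y) $ i))"
    by (intro sum.cong) (auto simp: gi)
  also have "\<dots> = poly (cpoly (monic_poly v)) x * y $ 0"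
    by (rule companion_left_power_row[OF v y n])
  finally show ?thesis using y n by (simp add: y_def A_def)
qed

text \<open>The state-space form says \<open>f = 1/2 + g(x) / a(x)\<close>; comparison with \<open>f = b / (2 a)\<close> gives \<open>b = a + 2 g\<close>.\<close>

lemma numerator_coeffs:
  assumes a: "a \<in> carrier_vec n" and b: "b \<in> carrier_vec n" and g: "g \<in> carrier_vec n" and n: "0 < n"
    and f: "\<And>x. poly (cpoly (monic_poly a)) x \<noteq> 0 \<Longrightarrow>
      1/2 * (poly (cpoly (monic_poly b)) x / poly (cpoly (monic_poly a)) x)
      = 1/2 + h_vec n \<bullet> (mat_inv (x \<cdot>\<^sub>m 1\<^sub>m n - cmat (companion a)) *\<^sub>v cvec g)"
    and i: "i < n"
  shows "g $ i = (b $ i - a $ i) / 2"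
proof -
  define Z where "Z = {x. poly (cpoly (monic_poly a)) x \<noteq> 0}"
  have "infinite Z"
    by (rule infinite_super[OF _ infinite_poly_nonzero[OF cpoly_monic_poly_nonzero[of a]]])
      (auto simp: Z_def)
  then obtain Y where Y: "Y \<subseteq> Z" "finite Y" "card Y = Suc n"
    using infinite_arbitrarily_large by blast
  define y :: "nat \<Rightarrow> complex" where "y j = of_real (vCons 1 b $ j - vCons 1 a $ j - 2 * vCons 0 g $ j)" for j
  have "y (Suc i) = 0"
  proof (rule power_sum_coeffs_zero[of n Y])
    fix x assume "x \<in> Y"
    hence x: "poly (cpoly (monic_poly a)) x \<noteq> 0" using Y by (auto simp: Z_def)
    have "poly (cpoly (monic_poly b)) x = poly (cpoly (monic_poly a)) x
        + 2 * (poly (cpoly (monic_poly a)) x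
           * (h_vec n \<bullet> (mat_inv (x \<cdot>\<^sub>m 1\<^sub>m n - cmat (companion a)) *\<^sub>v cvec g)))"
      using f[OF x] x by (simp add: field_simps)
    also have "poly (cpoly (monic_poly a)) x
           * (h_vec n \<bullet> (mat_inv (x \<cdot>\<^sub>m 1\<^sub>m n - cmat (companion a)) *\<^sub>v cvec g))
         = (\<Sum>i<n. x ^ (n - Suc i) * cvec g $ i)"
      by (rule companion_resolvent[OF a _ n x]) (use g in simp)
    also have "\<dots> = (\<Sum>j<Suc n. of_real (vCons 0 g $ j) * x ^ (n - j))"
      using g by (subst sum.lessThan_Suc_shift) (auto intro!: sum.cong)
    finally show "(\<Sum>j\<le>n. x ^ (n - j) * y j) = 0"
      unfolding poly_cpoly_monic_poly[OF a] poly_cpoly_monic_poly[OF b] y_def lessThan_Suc_atMost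
      by (simp add: algebra_simps sum.distrib sum_subtractf sum_distrib_left)
  qed (use Y i in auto)
  hence "b $ i - a $ i - 2 * g $ i = 0" unfolding y_def by (metis of_real_eq_0_iff vec_index_vCons_Suc)
  thus ?thesis by simp
qed

lemma spectral_form_diag_sums:
  assumes a: "a \<in> carrier_vec n" and b: "b \<in> carrier_vec n" and \<sigma>: "\<sigma> \<in> carrier_vec n"
    and f: "f = (\<lambda>x. 1/2 * (poly (cpoly (monic_poly b)) x / poly (cpoly (monic_poly a)) x))"
    and w: "w = (\<lambda>x. complex_of_real \<rho> *
                    (poly (cpoly (monic_poly \<sigma>)) x / poly (cpoly (monic_poly a)) x))"
    and spec: "\<And>x. x \<noteq> 0 \<Longrightarrow> poly (cpoly (monic_poly a)) x \<noteq> 0 \<Longrightarrow>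
      poly (cpoly (monic_poly a)) (inverse x) \<noteq> 0 \<Longrightarrow> f x + f (inverse x) = w x * w (inverse x)"
    and m: "m \<le> n"
  shows "diag_sum (spectral_form \<rho> \<sigma> a b) n m = 0"
proof -
  define Z where "Z = {x. x \<noteq> 0 \<and> poly (cpoly (monic_poly a)) x \<noteq> 0
    \<and> poly (cpoly (monic_poly a)) (inverse x) \<noteq> 0}"
  have "diag_sum (\<lambda>i j. complex_of_real (spectral_form \<rho> \<sigma> a b i j)) n m = 0"
  proof (rule diag_sum_zero[OF _ _ m])
    show "infinite Z" unfolding Z_def by (rule infinite_poly_nonzero[OF cpoly_monic_poly_nonzero])
    fix x assume "x \<in> Z"
    hence x: "x \<noteq> 0" "poly (cpoly (monic_poly a)) x \<noteq> 0" "poly (cpoly (monic_poly a)) (inverse x) \<noteq> 0"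
      by (auto simp: Z_def)
    define e where "e v y i = complex_of_real (vCons 1 v $ i) * y ^ (n - i)" for v :: "real vec" and y i
    have e: "poly (cpoly (monic_poly v)) y = (\<Sum>i\<le>n. e v y i)" if "v \<in> carrier_vec n" for v y
      unfolding e_def by (rule poly_cpoly_monic_poly[OF that])
    have prod: "(\<Sum>i\<le>n. \<Sum>j\<le>n. e u x i * e v (inverse x) j)
        = poly (cpoly (monic_poly u)) x * poly (cpoly (monic_poly v)) (inverse x)"
      if "u \<in> carrier_vec n" "v \<in> carrier_vec n" for u v
      unfolding e[OF that(1)] e[OF that(2)] by (simp add: sum_product)
    have "(\<Sum>i\<le>n. \<Sum>j\<le>n. complex_of_real (spectral_form \<rho> \<sigma> a b i j) * (x ^ (n - i) * inverse x ^ (n - j)))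
      = (\<Sum>i\<le>n. \<Sum>j\<le>n. complex_of_real \<rho>^2 * (e \<sigma> x i * e \<sigma> (inverse x) j)
          - (e a x i * e b (inverse x) j + e b x i * e a (inverse x) j) / 2)"
      by (intro sum.cong refl) (simp add: spectral_form_def e_def algebra_simps add_divide_distrib)
    also have "\<dots> = complex_of_real \<rho>^2 * (\<Sum>i\<le>n. \<Sum>j\<le>n. e \<sigma> x i * e \<sigma> (inverse x) j)
        - ((\<Sum>i\<le>n. \<Sum>j\<le>n. e a x i * e b (inverse x) j)
          + (\<Sum>i\<le>n. \<Sum>j\<le>n. e b x i * e a (inverse x) j)) / 2"
      by (simp add: sum_subtractf sum.distrib sum_distrib_left flip: sum_divide_distrib)
    also have "\<dots> = 0"
      unfolding prod[OF \<sigma> \<sigma>] prod[OF a b] prod[OF b a]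
      using spec[OF x] x unfolding f w by (simp add: field_simps power2_eq_square)
    finally show "x \<noteq> 0 \<and> (\<Sum>i\<le>n. \<Sum>j\<le>n. complex_of_real (spectral_form \<rho> \<sigma> a b i j)
        * (x ^ (n - i) * inverse x ^ (n - j))) = 0"
      using x by simp
  qed
  hence "complex_of_real (diag_sum (spectral_form \<rho> \<sigma> a b) n m) = 0"
    by (simp add: diag_sum_def)
  thus ?thesis by simp
qed

section \<open>The interpolation conditions\<close>

lemma vandermonde_carrier [simp]: "vandermonde n z \<in> carrier_mat (n + 1) (n + 1)"
  by (simp add: vandermonde_def)

lemma vandermonde_mult_vec:
  assumes "y \<in> carrier_vec (n + 1)" "k \<le> n"
  shows "(vandermonde n z *\<^sub>v y) $ k = (\<Sum>j\<le>n. z k ^ (n - j) * y $ j)"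
  using assms by (auto simp: vandermonde_def scalar_prod_def atLeast0LessThan lessThan_Suc_atMost)

lemma mat_inv_vandermonde:
  assumes "inj_on z {..n}"
  shows "mat_inv (vandermonde n z) \<in> carrier_mat (n + 1) (n + 1)"
    "mat_inv (vandermonde n z) * vandermonde n z = 1\<^sub>m (n + 1)"
proof -
  have ker: "y = 0\<^sub>v (n + 1)"
    if y: "y \<in> carrier_vec (n + 1)" and "vandermonde n z *\<^sub>v y = 0\<^sub>v (n + 1)" for y
  proof (rule eq_vecI)
    fix j assume "j < dim_vec (0\<^sub>v (n + 1))"
    have "y $ j = 0"
    proof (rule power_sum_coeffs_zero[of n "z ` {..n}"])
      fix x assume "x \<in> z ` {..n}"
      then obtain k where "k \<le> n" "x = z k" by auto
      thus "(\<Sum>j\<le>n. x ^ (n - j) * y $ j) = 0"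
        using vandermonde_mult_vec[OF y, of k z] that(2) by simp
    qed (use assms \<open>j < dim_vec (0\<^sub>v (n + 1))\<close> in \<open>auto simp: card_image\<close>)
    thus "y $ j = 0\<^sub>v (n + 1) $ j" using \<open>j < dim_vec (0\<^sub>v (n + 1))\<close> by simp
  qed (use y in auto)
  from mat_inv_of_trivial_kernel[OF vandermonde_carrier ker]
  show "mat_inv (vandermonde n z) \<in> carrier_mat (n + 1) (n + 1)"
    "mat_inv (vandermonde n z) * vandermonde n z = 1\<^sub>m (n + 1)" by auto
qed

lemma interp_mat_carrier:
  assumes "inj_on z {..n}"
  shows "interp_mat n z c \<in> carrier_mat (n + 1) (n + 1)"
  using mat_inv_vandermonde(1)[OF assms] by (simp add: interp_mat_def minus_carrier_mat)

text \<open>Evaluation at the nodes is multiplication by the Vandermonde matrix, and so the conditions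
  \<open>b(z_k) = 2 c_k a(z_k)\<close> say that \<open>2 V^(-1) C V\<close> takes the coefficients of \<open>a\<close> to those of \<open>b\<close>.\<close>

lemma interp_mat_mult:
  assumes z: "inj_on z {..n}" and a: "a \<in> carrier_vec n" and b: "b \<in> carrier_vec n" and g: "g \<in> carrier_vec n"
    and gi: "\<And>i. i < n \<Longrightarrow> g $ i = (b $ i - a $ i) / 2"
    and interp: "\<And>k. k \<le> n \<Longrightarrow> poly (cpoly (monic_poly b)) (z k) = 2 * c k * poly (cpoly (monic_poly a)) (z k)"
  shows "interp_mat n z c *\<^sub>v vCons 1 (cvec a) = vCons 0 (cvec g)"
proof -
  define V where "V = vandermonde n z"
  define N where "N = n + 1"
  define D where "D = mat_diag N c"
  define \<alpha> where "\<alpha> = vCons 1 (cvec a)"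
  define \<beta> where "\<beta> = vCons 1 (cvec b)"
  have V: "V \<in> carrier_mat N N" and D: "D \<in> carrier_mat N N"
    and \<alpha>: "\<alpha> \<in> carrier_vec N" and \<beta>: "\<beta> \<in> carrier_vec N"
    using a b vandermonde_carrier[of n z] by (auto simp del: vandermonde_carrier simp: V_def D_def \<alpha>_def \<beta>_def N_def)
  have Vi: "mat_inv V \<in> carrier_mat N N" "mat_inv V * V = 1\<^sub>m N"
    using mat_inv_vandermonde[OF z] by (auto simp: V_def N_def)
  have Vp: "(V *\<^sub>v vCons 1 (cvec v)) $ k = poly (cpoly (monic_poly v)) (z k)"
    if "v \<in> carrier_vec n" "k \<le> n" for v k
  proof -
    have "vCons 1 (cvec v) $ j = of_real (vCons 1 v $ j)" if "j \<le> n" for j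
      using that \<open>v \<in> carrier_vec n\<close> by (cases j) auto
    thus ?thesis
      using vandermonde_mult_vec[of "vCons 1 (cvec v)" n k z] that
      by (simp add: poly_cpoly_monic_poly V_def mult.commute)
  qed
  have "V *\<^sub>v \<beta> = 2 \<cdot>\<^sub>v (D *\<^sub>v (V *\<^sub>v \<alpha>))"
  proof (rule eq_vecI)
    fix k assume "k < dim_vec (2 \<cdot>\<^sub>v (D *\<^sub>v (V *\<^sub>v \<alpha>)))"
    hence k: "k < N" using D by simp
    have "(D *\<^sub>v (V *\<^sub>v \<alpha>)) $ k = (\<Sum>j<N. if j = k then c k * (V *\<^sub>v \<alpha>) $ k else 0)"
    proof -
      have "(D *\<^sub>v (V *\<^sub>v \<alpha>)) $ k = (\<Sum>j<N. D $$ (k, j) * (V *\<^sub>v \<alpha>) $ j)"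
        using k V D by (simp add: scalar_prod_def[of _ "V *\<^sub>v \<alpha>"] atLeast0LessThan)
      also have "\<dots> = (\<Sum>j<N. if j = k then c k * (V *\<^sub>v \<alpha>) $ k else 0)"
        using k by (intro sum.cong refl) (auto simp: D_def mat_diag_def simp del: index_mult_mat_vec)
      finally show ?thesis .
    qed
    hence "(D *\<^sub>v (V *\<^sub>v \<alpha>)) $ k = c k * (V *\<^sub>v \<alpha>) $ k" using k by simp
    thus "(V *\<^sub>v \<beta>) $ k = (2 \<cdot>\<^sub>v (D *\<^sub>v (V *\<^sub>v \<alpha>))) $ k"
      using k D Vp[OF a, of k] Vp[OF b, of k] interp[of k]
      by (simp add: \<alpha>_def \<beta>_def N_def del: index_mult_mat_vec)
  qed (use V D in auto)
  hence "mat_inv V *\<^sub>v (V *\<^sub>v \<beta>) = mat_inv V *\<^sub>v (2 \<cdot>\<^sub>v (D *\<^sub>v (V *\<^sub>v \<alpha>)))" by simp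
  also have "mat_inv V *\<^sub>v (V *\<^sub>v \<beta>) = \<beta>"
    using assoc_mult_mat_vec[OF Vi(1) V \<beta>] Vi(2) \<beta> by simp
  also have "mat_inv V *\<^sub>v (2 \<cdot>\<^sub>v (D *\<^sub>v (V *\<^sub>v \<alpha>))) = (2 \<cdot>\<^sub>m (mat_inv V * D * V)) *\<^sub>v \<alpha>"
    using Vi(1) V D \<alpha>
    by (simp add: smult_mat_mult_vec[of _ N N] assoc_mult_mat_vec[of _ N N _ N] mult_mat_vec[of _ N N])
  finally have \<beta>_eq: "(2 \<cdot>\<^sub>m (mat_inv V * D * V)) *\<^sub>v \<alpha> = \<beta>" ..
  have "interp_mat n z c *\<^sub>v \<alpha> = (1/2) \<cdot>\<^sub>v (\<beta> - \<alpha>)"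
  proof -
    have W: "2 \<cdot>\<^sub>m (mat_inv V * D * V) \<in> carrier_mat N N" using Vi V D by simp
    have "interp_mat n z c *\<^sub>v \<alpha> = ((1/2) \<cdot>\<^sub>m (2 \<cdot>\<^sub>m (mat_inv V * D * V) - 1\<^sub>m N)) *\<^sub>v \<alpha>"
      by (simp add: interp_mat_def V_def D_def N_def)
    also have "\<dots> = (1/2) \<cdot>\<^sub>v ((2 \<cdot>\<^sub>m (mat_inv V * D * V) - 1\<^sub>m N) *\<^sub>v \<alpha>)"
      by (rule smult_mat_mult_vec[OF minus_carrier_mat[OF one_carrier_mat] \<alpha>])
    also have "(2 \<cdot>\<^sub>m (mat_inv V * D * V) - 1\<^sub>m N) *\<^sub>v \<alpha> = \<beta> - \<alpha>"
      using minus_mult_distrib_mat_vec[OF W one_carrier_mat \<alpha>] \<alpha> \<beta>_eq by simp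
    finally show ?thesis .
  qed
  also have "\<dots> = vCons 0 (cvec g)"
  proof (rule eq_vecI)
    fix j assume "j < dim_vec (vCons 0 (cvec g))"
    thus "((1/2) \<cdot>\<^sub>v (\<beta> - \<alpha>)) $ j = vCons 0 (cvec g) $ j"
      using a b g by (cases j) (auto simp: \<alpha>_def \<beta>_def gi)
  qed (use \<alpha> g in \<open>auto simp: N_def\<close>)
  finally show ?thesis by (simp add: \<alpha>_def)
qed

lemma cvec_add:
  assumes "x \<in> carrier_vec n" "y \<in> carrier_vec n"
  shows "cvec (x + y) = cvec x + cvec y"
  using assms by (intro eq_vecI) auto

lemma augment_index:
  assumes "u \<in> carrier_vec m" "A \<in> carrier_mat m n" "i < m" "j < Suc n"
  shows "augment u A $$ (i, j) = (case j of 0 \<Rightarrow> u $ i | Suc l \<Rightarrow> A $$ (i, l))"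
  using assms by (auto simp: augment_def mat_of_cols_index split: nat.split)

lemma augment_carrier:
  assumes "u \<in> carrier_vec m" "A \<in> carrier_mat m n"
  shows "augment u A \<in> carrier_mat m (Suc n)"
  using assms by (auto simp: augment_def mat_of_cols_def)

lemma augment_mult_vCons:
  fixes A :: "'a :: comm_semiring_1 mat"
  assumes "u \<in> carrier_vec m" "A \<in> carrier_mat m n" "y \<in> carrier_vec n"
  shows "augment u A *\<^sub>v vCons t y = t \<cdot>\<^sub>v u + A *\<^sub>v y"
proof (rule eq_vecI)
  fix i assume "i < dim_vec (t \<cdot>\<^sub>v u + A *\<^sub>v y)"
  hence i: "i < m" using assms by simp
  have "(augment u A *\<^sub>v vCons t y) $ i = (\<Sum>j<Suc n. augment u A $$ (i, j) * vCons t y $ j)"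
    using augment_carrier[OF assms(1,2)] i assms(3)
    by (simp add: scalar_prod_def atLeast0LessThan del: sum.lessThan_Suc)
  also have "\<dots> = u $ i * t + (\<Sum>j<n. A $$ (i, j) * y $ j)"
    by (subst sum.lessThan_Suc_shift) (simp add: augment_index[OF assms(1,2) i])
  finally show "(augment u A *\<^sub>v vCons t y) $ i = (t \<cdot>\<^sub>v u + A *\<^sub>v y) $ i"
    using assms i by (simp add: scalar_prod_def atLeast0LessThan mult.commute)
qed (use assms augment_carrier[OF assms(1,2)] in auto)

text \<open>Adding \<open>(1, a)\<close> to \<open>T (1, a) = (0, g)\<close> gives \<open>(I + T) (1, a) = (1, a + g)\<close>. As \<open>T\<close> commutes with
  \<open>(I + T)^(-1)\<close>, the matrix \<open>[u U]\<close> takes \<open>(1, a + g)\<close> to the lower part of \<open>T (1, a)\<close>, which is \<open>g\<close>.\<close>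

lemma interpolation_gain:
  fixes T U :: "complex mat"
  assumes T: "T \<in> carrier_mat (n + 1) (n + 1)" and inv: "invertible_mat (1\<^sub>m (n + 1) + T)"
    and u: "u \<in> carrier_vec n" and U: "U \<in> carrier_mat n n"
    and aug: "augment u U = augment (0\<^sub>v n) (1\<^sub>m n) * mat_inv (1\<^sub>m (n + 1) + T) * T"
    and a: "a \<in> carrier_vec n" and g: "g \<in> carrier_vec n"
    and Ta: "T *\<^sub>v vCons 1 a = vCons 0 g"
  shows "g = u + U *\<^sub>v (a + g)"
proof -
  define N where "N = n + 1"
  define W where "W = 1\<^sub>m N + T"
  define \<alpha> where "\<alpha> = vCons 1 a"
  define \<gamma> where "\<gamma> = vCons 0 g"
  define E :: "complex mat" where "E = augment (0\<^sub>v n) (1\<^sub>m n)"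
  have T': "T \<in> carrier_mat N N" and W: "W \<in> carrier_mat N N"
    and \<alpha>: "\<alpha> \<in> carrier_vec N" and \<gamma>: "\<gamma> \<in> carrier_vec N" and E: "E \<in> carrier_mat n N"
    using T a g augment_carrier[of "0\<^sub>v n" n "1\<^sub>m n" n]
    by (auto simp: W_def N_def \<alpha>_def \<gamma>_def E_def)
  have Wi: "mat_inv W \<in> carrier_mat N N" "mat_inv W * W = 1\<^sub>m N"
    using mat_inv_of_invertible[OF W] inv by (auto simp: W_def N_def)
  have W\<alpha>: "W *\<^sub>v \<alpha> = vCons 1 (a + g)"
  proof -
    have "W *\<^sub>v \<alpha> = \<alpha> + \<gamma>"
      unfolding W_def using add_mult_distrib_mat_vec[OF one_carrier_mat T' \<alpha>] \<alpha> Ta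
      by (simp add: \<alpha>_def \<gamma>_def)
    also have "\<dots> = vCons 1 (a + g)"
    proof (rule eq_vecI)
      fix j assume "j < dim_vec (vCons 1 (a + g))"
      thus "(\<alpha> + \<gamma>) $ j = vCons 1 (a + g) $ j"
        using a g by (cases j) (auto simp: \<alpha>_def \<gamma>_def)
    qed (use a g in \<open>auto simp: \<alpha>_def \<gamma>_def\<close>)
    finally show ?thesis .
  qed
  have TW: "T * W = W * T"
    using T' unfolding W_def
    by (simp add: mult_add_distrib_mat[of T N N _ N] add_mult_distrib_mat[of _ N N _ _ N])
  have "u + U *\<^sub>v (a + g) = augment u U *\<^sub>v (W *\<^sub>v \<alpha>)"
    using augment_mult_vCons[OF u U, of "a + g" 1] a g u by (simp add: W\<alpha>)
  also have "\<dots> = E *\<^sub>v (mat_inv W *\<^sub>v (T *\<^sub>v (W *\<^sub>v \<alpha>)))"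
    unfolding aug N_def[symmetric] W_def[symmetric] E_def[symmetric]
    using E T' W Wi \<alpha> by (simp add: assoc_mult_mat_vec[of _ n N _ N] assoc_mult_mat_vec[of _ N N _ N])
  also have "T *\<^sub>v (W *\<^sub>v \<alpha>) = W *\<^sub>v (T *\<^sub>v \<alpha>)"
    using assoc_mult_mat_vec[OF T' W \<alpha>] assoc_mult_mat_vec[OF W T' \<alpha>] TW by simp
  also have "mat_inv W *\<^sub>v (W *\<^sub>v (T *\<^sub>v \<alpha>)) = T *\<^sub>v \<alpha>"
    using assoc_mult_mat_vec[OF Wi(1) W, of "T *\<^sub>v \<alpha>"] Wi(2)
      mult_mat_vec_in_carrier[OF T', of \<alpha>] by simp
  also have "E *\<^sub>v (T *\<^sub>v \<alpha>) = g"
    using augment_mult_vCons[of "0\<^sub>v n" n "1\<^sub>m n" n g 0] g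
    by (simp add: Ta \<alpha>_def E_def) (auto intro!: eq_vecI)
  finally show ?thesis ..
qed

section \<open>The Covariance Extension Equation for Nevanlinna-Pick interpolation\<close>

theorem mainTheorem1:
  fixes n :: nat
    and z c :: "nat \<Rightarrow> complex"
    and a b \<sigma> g :: "real vec"
    and \<rho> :: real
    and f w :: "complex \<Rightarrow> complex"
    and T U :: "complex mat"
    and u :: "complex vec"
    and F \<Gamma> P :: "real mat"
  assumes "n \<ge> 1"
    and "inj_on z {..n}"
    and "\<forall>k\<le>n. cmod (z k) > 1"
    and "\<forall>k\<le>n. Re (c k) > 0"
    and "a \<in> carrier_vec n" and "b \<in> carrier_vec n" and "\<sigma> \<in> carrier_vec n"
    and "schur_poly (monic_poly a)"
    and "schur_poly (monic_poly b)"
    and "schur_poly (monic_poly \<sigma>)"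
    and "\<rho> > 0"
    and "f = (\<lambda>x. 1/2 * (poly (cpoly (monic_poly b)) x / poly (cpoly (monic_poly a)) x))"
    and "w = (\<lambda>x. complex_of_real \<rho> *
                    (poly (cpoly (monic_poly \<sigma>)) x / poly (cpoly (monic_poly a)) x))"
    and "positive_real f"
    and "\<forall>x. x \<noteq> 0 \<and> poly (cpoly (monic_poly a)) x \<noteq> 0 \<and>
             poly (cpoly (monic_poly a)) (inverse x) \<noteq> 0 \<longrightarrow>
             f x + f (inverse x) = w x * w (inverse x)"
    and "\<forall>k\<le>n. f (z k) = c k"
    and "T = interp_mat n z c"
    and "invertible_mat (1\<^sub>m (n + 1) + T)"
    and "u \<in> carrier_vec n" and "U \<in> carrier_mat n n"
    and "augment u U = augment (0\<^sub>v n) (1\<^sub>m n) * mat_inv (1\<^sub>m (n + 1) + T) * T"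
    and "F = companion a" and "\<Gamma> = companion \<sigma>"
    and "g \<in> carrier_vec n"
    and "\<forall>x. poly (cpoly (monic_poly a)) x \<noteq> 0 \<longrightarrow>
             f x = 1/2 + h_vec n \<bullet> (mat_inv (x \<cdot>\<^sub>m 1\<^sub>m n - cmat F) *\<^sub>v cvec g)"
    and "minimal_riccati_solution n F g P"
  shows "cvec g = g_fun u U \<sigma> P \<and>
    cmat P = cmat (\<Gamma> * (P - P * outer_prod (h_vec n) (h_vec n) * P) * \<Gamma>\<^sup>T)
             + outer_prod (g_fun u U \<sigma> P) (g_fun u U \<sigma> P) \<and>
    cvec a = (1\<^sub>m n - U) *\<^sub>v cvec (\<Gamma> *\<^sub>v (P *\<^sub>v h_vec n) + \<sigma>) - u \<and>
    \<rho> = sqrt (1 - h_vec n \<bullet> (P *\<^sub>v h_vec n))"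
proof -
  note z = assms(2) and a = assms(5) and b = assms(6) and \<sigma> = assms(7) and \<rho> = assms(11)
    and f = assms(12) and w = assms(13) and T = assms(17) and u = assms(19) and U = assms(20)
    and g = assms(24) and minimal = assms(26)
  have n: "0 < n" using assms(1) by simp
  have gi: "g $ i = (b $ i - a $ i) / 2" if "i < n" for i
  proof (rule numerator_coeffs[OF a b g n _ that])
    fix x assume "poly (cpoly (monic_poly a)) x \<noteq> 0"
    thus "1/2 * (poly (cpoly (monic_poly b)) x / poly (cpoly (monic_poly a)) x)
        = 1/2 + h_vec n \<bullet> (mat_inv (x \<cdot>\<^sub>m 1\<^sub>m n - cmat (companion a)) *\<^sub>v cvec g)"
      using assms(25) unfolding f assms(22) by blast
  qed
  interpret spectral_data n a b \<sigma> g \<rho>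
    by unfold_locales
      (use n a b \<sigma> g gi \<rho> spectral_form_diag_sums[OF a b \<sigma> f w] assms(15) in auto)
  have P: "P = M" using minimal assms(10) unfolding assms(22) by (rule minimal_eq_M)

  have interp: "poly (cpoly (monic_poly b)) (z k) = 2 * c k * poly (cpoly (monic_poly a)) (z k)"
    if "k \<le> n" for k
  proof -
    have "poly (cpoly (monic_poly a)) (z k) \<noteq> 0"
      using assms(3,8) that by (auto simp: schur_poly_def dest!: spec[of _ "z k"])
    moreover have "c k = 1/2 * (poly (cpoly (monic_poly b)) (z k) / poly (cpoly (monic_poly a)) (z k))"
      using assms(16) that by (simp add: f)
    ultimately show ?thesis by (simp add: field_simps)
  qed
  have Ta: "T *\<^sub>v vCons 1 (cvec a) = vCons 0 (cvec g)"
    unfolding T by (rule interp_mat_mult[OF z a b g gi interp])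
  have Tc: "T \<in> carrier_mat (n + 1) (n + 1)"
    unfolding T by (rule interp_mat_carrier[OF z])
  have ca: "cvec a \<in> carrier_vec n" and cg: "cvec g \<in> carrier_vec n" using a g by auto
  have gain: "cvec g = u + U *\<^sub>v (cvec a + cvec g)"
    by (rule interpolation_gain[OF Tc assms(18) u U assms(21) ca cg Ta])

  define t where "t = \<Gamma> *\<^sub>v (P *\<^sub>v h_vec n)"
  have tc: "t \<in> carrier_vec n"
    unfolding t_def assms(23) by (rule mult_mat_vec_in_carrier[OF companion_carrier[OF \<sigma>]])
  have "t + \<sigma> = a + g" unfolding t_def P assms(23) by (rule Gamma_M_h_plus_sigma)
  hence ag: "cvec a + cvec g = cvec t + cvec \<sigma>"
    by (simp flip: cvec_add[OF a g] cvec_add[OF tc \<sigma>])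
  have gP: "g_fun u U \<sigma> P = cvec g"
  proof -
    have "g_fun u U \<sigma> P = u + U *\<^sub>v cvec \<sigma> + U *\<^sub>v cvec t"
      using \<sigma> by (simp add: g_fun_def t_def assms(23))
    also have "\<dots> = u + (U *\<^sub>v cvec \<sigma> + U *\<^sub>v cvec t)"
      using u mult_mat_vec_in_carrier[OF U] by (intro assoc_add_vec)
    also have "\<dots> = u + (U *\<^sub>v cvec t + U *\<^sub>v cvec \<sigma>)"
      using mult_mat_vec_in_carrier[OF U] by (subst comm_add_vec) auto
    also have "\<dots> = u + U *\<^sub>v (cvec t + cvec \<sigma>)"
      using U \<sigma> tc by (subst mult_add_distrib_mat_vec[of _ n n]) auto
    finally show ?thesis using gain unfolding ag by simp
  qed
  have "cmat P = cmat (\<Gamma> * (P - P * outer_prod (h_vec n) (h_vec n) * P) * \<Gamma>\<^sup>T) + outer_prod (cvec g) (cvec g)"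
  proof -
    define X where "X = \<Gamma> * (P - P * outer_prod (h_vec n) (h_vec n) * P) * \<Gamma>\<^sup>T"
    have "X \<in> carrier_mat n n"
      unfolding X_def assms(23) using \<sigma> by (auto intro!: carrier_matI)
    moreover have "P = X + outer_prod g g"
      unfolding X_def P assms(23) by (rule covariance_extension_equation)
    ultimately show ?thesis
      unfolding X_def[symmetric] using g by (intro eq_matI) (auto simp: outer_prod_def)
  qed
  moreover have "cvec a = (1\<^sub>m n - U) *\<^sub>v cvec (t + \<sigma>) - u"
  proof (rule eq_vecI)
    have "(1\<^sub>m n - U) *\<^sub>v (cvec a + cvec g) = (cvec a + cvec g) - U *\<^sub>v (cvec a + cvec g)"
      using ca cg U by (subst minus_mult_distrib_mat_vec[of _ n n]) auto
    moreover fix i assume "i < dim_vec ((1\<^sub>m n - U) *\<^sub>v cvec (t + \<sigma>) - u)"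
    hence "i < n" using u by simp
    moreover have "cvec g $ i = u $ i + (U *\<^sub>v (cvec a + cvec g)) $ i"
      using arg_cong[OF gain, of "\<lambda>v. v $ i"] \<open>i < n\<close> u U by (simp del: index_mult_mat_vec index_map_vec)
    moreover have "cvec (t + \<sigma>) = cvec a + cvec g"
      using ag cvec_add[OF tc \<sigma>] by simp
    ultimately show "cvec a $ i = ((1\<^sub>m n - U) *\<^sub>v cvec (t + \<sigma>) - u) $ i"
      using a g u U by (simp del: index_mult_mat_vec)
  qed (use a u in auto)
  ultimately show ?thesis
    using gP rho_eq by (simp add: t_def P)
qed

end
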